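(* Let $\mathfrak A=(A,Q)$ be a finite quadratic module of level $N$ with even signature, and let $\ell$ be a prime with $\ell\equiv1\pmod N$ and $(N,\ell)\neq(2,3)$. Fix a primitive $N$th root of unity $\zeta\in\mathbb Q_\ell$ and set $e(k/N):=\zeta^k$. Let $G_N=\mathrm{SL}_2(\mathbb Z/N\mathbb Z)$ act on $\mathbb Q_\ell[A]$ via the Weil representation, defined on generators by $T\mathfrak e_x=e(Q(x))\mathfrak e_x$ and $S\mathfrak e_x=w\sum_{y\in A}e(-Q(x,y))\mathfrak e_y$ with $w=|A|^{-1}\sum_{z\in A}e(-Q(z))$ (this preserves $\mathbb Z_\ell[A]$), and let $G_N$ act on $\mathbb F_\ell[A]\cong\mathbb Z_\ell[A]/\ell\mathbb Z_\ell[A]$ by the induced action. Then $$\dim_{\mathbb Q_\ell}\mathbb Q_\ell[A]^{G_N}=\dim_{\mathbb F_\ell}\mathbb F_\ell[A]^{G_N}.$$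
   Context: A finite quadratic module is a pair $\mathfrak A=(A,Q)$ with $A$ a finite abelian group and $Q:A\to\mathbb Q/\mathbb Z$ a quadratic form whose bilinear form $Q(x,y)=Q(x+y)-Q(x)-Q(y)$ is non-degenerate; its level is $N=\min\{n\ge1: nQ(A)\subseteq\mathbb Z\}$, so all $Q(x)$, $Q(x,y)$ lie in $\frac1N\mathbb Z/\mathbb Z$. The signature $\operatorname{sig}(\mathfrak A)\in\mathbb Z/8\mathbb Z$ is defined by $|A|^{-1/2}\sum_{x\in A}e^{2\pi iQ(x)}=e^{2\pi i\operatorname{sig}(\mathfrak A)/8}$; over $\mathbb C$ the Weil representation is $T\mathfrak e_x=e^{2\pi iQ(x)}\mathfrak e_x$, $S\mathfrak e_x=\frac{e^{-2\pi i\operatorname{sig}(\mathfrak A)/8}}{\sqrt{|A|}}\sum_y e^{-2\pi iQ(x,y)}\mathfrak e_y$ (with $T=\begin{pmatrix}1&1\\0&1\end{pmatrix}$, $S=\begin{pmatrix}0&-1\\1&0\end{pmatrix}$), and for even signature it factors through $\mathrm{SL}_2(\mathbb Z/N\mathbb Z)$; note $\frac{e^{-2\pi i\operatorname{sig}/8}}{\sqrt{|A|}}=|A|^{-1}\sum_z e^{-2\pi iQ(z)}$, so the representation is defined over the $N$th cyclotomic field, which embeds in $\mathbb Q_\ell$ since $\ell\equiv1\pmod N$. Here $(\mathfrak e_x)_{x\in A}$ is the standard basis of the group algebra over the relevant ring, and $V^{G_N}$ denotes the $G_N$-fixed vectors. *)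

theory Defs
  imports
    "HOL-Analysis.Analysis"
    "HOL-Algebra.Group_Action"
    "HOL-Algebra.IntRing"
    "HOL-Computational_Algebra.Fraction_Field"
    "Berlekamp_Zassenhaus.Finite_Field"
begin

section \<open>The group of rationals modulo the integers\<close>

quotient_type rat_mod_int = rat / "\<lambda>x y. x - y \<in> \<int>"
proof (rule equivpI)
  show "reflp (\<lambda>x y::rat. x - y \<in> \<int>)"
    by (auto simp: reflp_def)
  show "symp (\<lambda>x y::rat. x - y \<in> \<int>)"
    by (metis (no_types, lifting) sympI Ints_minus minus_diff_eq)
  show "transp (\<lambda>x y::rat. x - y \<in> \<int>)"
  proof (rule transpI)
    fix x y z :: rat
    assume "x - y \<in> \<int>" "y - z \<in> \<int>"
    then have "(x - y) + (y - z) \<in> \<int>" by (rule Ints_add)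
    then show "x - z \<in> \<int>" by simp
  qed
qed

instantiation rat_mod_int :: ab_group_add
begin

lift_definition zero_rat_mod_int :: rat_mod_int is 0 .

lift_definition plus_rat_mod_int :: "rat_mod_int \<Rightarrow> rat_mod_int \<Rightarrow> rat_mod_int" is "(+)"
  by (metis (no_types, lifting) Ints_add add_diff_add)

lift_definition uminus_rat_mod_int :: "rat_mod_int \<Rightarrow> rat_mod_int" is uminus
  by (metis Ints_minus minus_diff_minus)

lift_definition minus_rat_mod_int :: "rat_mod_int \<Rightarrow> rat_mod_int \<Rightarrow> rat_mod_int" is "(-)"
proof -
  fix a b c d :: rat
  assume "a - b \<in> \<int>" "c - d \<in> \<int>"
  then have "(a - b) - (c - d) \<in> \<int>" by (rule Ints_diff)
  then show "a - c - (b - d) \<in> \<int>" by (simp add: algebra_simps)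
qed

instance
  by standard (transfer; simp add: algebra_simps)+

end

lift_definition rat_class :: "rat \<Rightarrow> rat_mod_int" is "\<lambda>x. x" .

lift_definition cexp_rat_mod_int :: "rat_mod_int \<Rightarrow> complex"
  is "\<lambda>r. exp (2 * of_real pi * \<i> * of_rat r)"
proof -
  fix r s :: rat
  assume "r - s \<in> \<int>"
  then obtain k where "r - s = of_int k" by (auto elim: Ints_cases)
  then have "r = s + of_int k" by simp
  then have "(2 * of_real pi * \<i> * of_rat r :: complex)
      = 2 * of_real pi * \<i> * of_rat s + \<i> * (of_int k * (of_real pi * 2))"
    by (simp add: of_rat_add distrib_left)
  then show "exp (2 * of_real pi * \<i> * of_rat r) = (exp (2 * of_real pi * \<i> * of_rat s) :: complex)"
    by (simp only: exp_add exp_2pi_1_int mult_1_right)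
qed


section \<open>Finite quadratic modules\<close>

definition int_mult :: "int \<Rightarrow> 'a::ab_group_add \<Rightarrow> 'a" where
  "int_mult k x = (if 0 \<le> k then (\<Sum>i<nat k. x) else - (\<Sum>i<nat (- k). x))"

definition polar :: "('a::ab_group_add \<Rightarrow> rat_mod_int) \<Rightarrow> 'a \<Rightarrow> 'a \<Rightarrow> rat_mod_int" where
  "polar Q x y = Q (x + y) - Q x - Q y"

definition quadratic_form :: "('a::ab_group_add \<Rightarrow> rat_mod_int) \<Rightarrow> bool" where
  "quadratic_form Q \<longleftrightarrow>
     (\<forall>k x. Q (int_mult k x) = int_mult (k ^ 2) (Q x)) \<and>
     (\<forall>x y z. polar Q (x + y) z = polar Q x z + polar Q y z) \<and>
     (\<forall>x y z. polar Q x (y + z) = polar Q x y + polar Q x z)"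

definition finite_quadratic_module :: "('a::{finite,ab_group_add} \<Rightarrow> rat_mod_int) \<Rightarrow> bool" where
  "finite_quadratic_module Q \<longleftrightarrow>
     quadratic_form Q \<and> (\<forall>x. (\<forall>y. polar Q x y = 0) \<longrightarrow> x = 0)"

definition level :: "('a::{finite,ab_group_add} \<Rightarrow> rat_mod_int) \<Rightarrow> nat" where
  "level Q = (LEAST n. 1 \<le> n \<and> (\<forall>x. int_mult (int n) (Q x) = 0))"

text \<open>
  The signature is an element of the integers modulo 8, represented here by its
  representative in \<open>{0..<8}\<close>.
\<close>

definition signature :: "('a::{finite,ab_group_add} \<Rightarrow> rat_mod_int) \<Rightarrow> int" where
  "signature Q = (THE s. 0 \<le> s \<and> s < 8 \<and>
     (\<Sum>x\<in>UNIV. cexp_rat_mod_int (Q x)) / of_real (sqrt (real CARD('a)))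
       = exp (2 * of_real pi * \<i> * of_int s / 8))"


section \<open>The \<open>\<ell>\<close>-adic integers and numbers\<close>

text \<open>
  The prime \<open>\<ell>\<close> is the cardinality of the index type. A sequence \<open>f\<close> in the inverse limit
  stores in \<open>f n\<close> the representative in \<open>{0..<\<ell> ^ n}\<close> of its component modulo \<open>\<ell> ^ n\<close>.
\<close>

typedef (overloaded) ('p::prime_card) padic_int =
  "{f :: nat \<Rightarrow> int. \<forall>n. f (Suc n) mod int CARD('p) ^ n = f n}"
  by (rule exI [of _ "\<lambda>_. 0"]) simp

setup_lifting type_definition_padic_int

lemma mod_power_Suc_mod: "(a::int) mod p ^ Suc n mod p ^ n = a mod p ^ n"
  by (rule mod_mod_cancel) simp

lemma one_less_CARD_prime: "1 < int CARD('p::prime_card)"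
  using prime_card [where 'a = 'p] prime_gt_1_nat by auto

instantiation padic_int :: (prime_card) comm_ring_1
begin

lift_definition zero_padic_int :: "'a padic_int" is "\<lambda>_. 0" by simp

lift_definition one_padic_int :: "'a padic_int" is "\<lambda>n. 1 mod int CARD('a) ^ n"
  by (rule mod_power_Suc_mod)

lift_definition plus_padic_int :: "'a padic_int \<Rightarrow> 'a padic_int \<Rightarrow> 'a padic_int"
  is "\<lambda>f g n. (f n + g n) mod int CARD('a) ^ n"
  by (subst mod_power_Suc_mod) (metis mod_add_eq)

lift_definition times_padic_int :: "'a padic_int \<Rightarrow> 'a padic_int \<Rightarrow> 'a padic_int"
  is "\<lambda>f g n. (f n * g n) mod int CARD('a) ^ n"
  by (subst mod_power_Suc_mod) (metis mod_mult_eq)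

lift_definition uminus_padic_int :: "'a padic_int \<Rightarrow> 'a padic_int"
  is "\<lambda>f n. (- f n) mod int CARD('a) ^ n"
  by (subst mod_power_Suc_mod) (metis mod_minus_eq)

lift_definition minus_padic_int :: "'a padic_int \<Rightarrow> 'a padic_int \<Rightarrow> 'a padic_int"
  is "\<lambda>f g n. (f n - g n) mod int CARD('a) ^ n"
  by (subst mod_power_Suc_mod) (metis mod_diff_eq)

instance
proof
  fix a b c :: "'a padic_int"
  show "a * b * c = a * (b * c)"
    by transfer (simp only: mod_mult_left_eq mod_mult_right_eq mult.assoc)
  show "a * b = b * a" by transfer (simp only: mult.commute)
  have reduced: "f n mod int CARD('a) ^ n = f n"
    if "\<forall>n. f (Suc n) mod int CARD('a) ^ n = f n" for f :: "nat \<Rightarrow> int" and n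
    using that by (metis mod_mod_trivial)
  show "1 * a = a"
    by transfer (rule ext, metis mod_mult_left_eq mult_1 reduced)
  show "a + b + c = a + (b + c)"
    by transfer (simp only: mod_add_left_eq mod_add_right_eq add.assoc)
  show "a + b = b + a" by transfer (simp only: add.commute)
  show "0 + a = a"
    by transfer (rule ext, metis add_0 reduced)
  show "- a + a = 0"
    by transfer (simp only: mod_add_left_eq left_minus mod_0)
  show "a - b = a + - b"
    by transfer (simp only: mod_add_right_eq diff_conv_add_uminus)
  show "(a + b) * c = a * c + b * c"
    by transfer (simp only: mod_mult_left_eq mod_add_eq distrib_right)
  show "(0::'a padic_int) \<noteq> 1"
  proof
    assume "(0::'a padic_int) = 1"
    then have "Rep_padic_int (0::'a padic_int) 1 = Rep_padic_int (1::'a padic_int) 1" by simp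
    then show False
      using one_less_CARD_prime [where 'p = 'a]
      by (simp add: zero_padic_int.rep_eq one_padic_int.rep_eq)
  qed
qed

end

lemma Rep_padic_int_mod:
  fixes x :: "'p::prime_card padic_int"
  shows "Rep_padic_int x n = Rep_padic_int x (n + m) mod int CARD('p) ^ n"
proof (induction m)
  case 0
  have "Rep_padic_int x n = Rep_padic_int x (Suc n) mod int CARD('p) ^ n"
    using Rep_padic_int [of x] by auto
  then show ?case by (metis add_0_right mod_mod_trivial)
next
  case (Suc m)
  have "Rep_padic_int x (n + m) = Rep_padic_int x (Suc (n + m)) mod int CARD('p) ^ (n + m)"
    using Rep_padic_int [of x] by auto
  then have "Rep_padic_int x (n + m) mod int CARD('p) ^ n
      = Rep_padic_int x (Suc (n + m)) mod int CARD('p) ^ n"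
    by (simp add: mod_mod_cancel le_imp_power_dvd)
  then show ?case using Suc by simp
qed

lemma power_dvd_mult_cases:
  fixes p a b :: int
  assumes "prime p" "p ^ (m + n) dvd a * b"
  shows "p ^ m dvd a \<or> p ^ n dvd b"
  using assms(2)
proof (induction m arbitrary: a)
  case 0
  then show ?case by simp
next
  case (Suc m)
  show ?case
  proof (cases "p dvd a")
    case True
    then obtain a' where a: "a = p * a'" by blast
    have "p \<noteq> 0" using assms(1) by auto
    then have "p ^ (m + n) dvd a' * b" using Suc.prems by (simp add: a mult.assoc)
    from Suc.IH [OF this] show ?thesis by (auto simp: a)
  next
    case False
    then have "coprime (p ^ (Suc m + n)) a"
      using assms(1) by (simp add: prime_imp_coprime del: power_Suc)
    then have "p ^ (Suc m + n) dvd b"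
      using Suc.prems coprime_dvd_mult_right_iff by blast
    then have "p ^ n dvd b" by (metis power_le_dvd le_add2)
    then show ?thesis ..
  qed
qed

instance padic_int :: (prime_card) idom
proof
  fix x y :: "'a padic_int"
  assume "x \<noteq> 0" "y \<noteq> 0"
  then obtain m n where mn: "Rep_padic_int x m \<noteq> 0" "Rep_padic_int y n \<noteq> 0"
    by (metis Rep_padic_int_inject ext zero_padic_int.rep_eq)
  let ?p = "int CARD('a)"
  have "\<not> ?p ^ m dvd Rep_padic_int x (m + n)"
    using mn(1) Rep_padic_int_mod [of x m n] by auto
  moreover have "\<not> ?p ^ n dvd Rep_padic_int y (m + n)"
    using mn(2) Rep_padic_int_mod [of y n m] by (auto simp: add.commute)
  ultimately have "\<not> ?p ^ (m + n) dvd Rep_padic_int x (m + n) * Rep_padic_int y (m + n)"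
    using power_dvd_mult_cases [OF prime_card_int] by blast
  then have "Rep_padic_int (x * y) (m + n) \<noteq> 0"
    by (simp add: times_padic_int.rep_eq dvd_eq_mod_eq_0)
  then show "x * y \<noteq> 0" by (metis zero_padic_int.rep_eq)
qed

type_synonym 'p padic = "'p padic_int fract"

definition padic_of_int :: "'p::prime_card padic_int \<Rightarrow> 'p padic" where
  "padic_of_int a = Fract a 1"

definition padic_residue :: "'p::prime_card padic_int \<Rightarrow> 'p mod_ring" where
  "padic_residue a = of_int_mod_ring (Rep_padic_int a 1)"

lemma padic_residue_add: "padic_residue (a + b) = padic_residue a + padic_residue b"
  unfolding padic_residue_def plus_padic_int.rep_eq
  by transfer (simp add: mod_simps)

lemma padic_residue_mult: "padic_residue (a * b) = padic_residue a * padic_residue b"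
  unfolding padic_residue_def times_padic_int.rep_eq
  by transfer (simp add: mod_simps)

lemma padic_residue_one: "padic_residue 1 = 1"
  unfolding padic_residue_def one_padic_int.rep_eq
  using one_less_CARD_prime [where 'p = 'a] by transfer simp

lemma Rep_of_nat_padic_int:
  "Rep_padic_int (of_nat k :: 'p::prime_card padic_int) n = int k mod int CARD('p) ^ n"
  by (induction k)
    (simp_all add: zero_padic_int.rep_eq one_padic_int.rep_eq plus_padic_int.rep_eq mod_simps)

lemma surj_padic_residue: "surj (padic_residue :: 'p::prime_card padic_int \<Rightarrow> 'p mod_ring)"
proof (rule surjI)
  fix x :: "'p mod_ring"
  have "padic_residue (of_nat k) = (of_nat k :: 'p mod_ring)" for k
    by (induction k)
      (simp_all add: padic_residue_add padic_residue_one,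
        simp add: padic_residue_def zero_padic_int.rep_eq)
  then show "padic_residue (of_nat (SOME k. of_nat k = x)) = x"
    using surj_of_nat_mod_ring [of x] by (metis (mono_tags, lifting) someI_ex)
qed

text \<open>
  Together with the previous facts, this identifies \<open>\<int>\<^sub>\<ell> / \<ell> \<int>\<^sub>\<ell>\<close> with the field \<open>'p mod_ring\<close>.
\<close>

lemma padic_residue_eq_0_iff:
  fixes a :: "'p::prime_card padic_int"
  shows "padic_residue a = 0 \<longleftrightarrow> of_nat CARD('p) dvd a"
proof
  let ?p = "int CARD('p)"
  assume "of_nat CARD('p) dvd a"
  then obtain b where "a = of_nat CARD('p) * b" by blast
  then have "Rep_padic_int a 1 = 0"
    by (simp add: times_padic_int.rep_eq Rep_of_nat_padic_int)
  then show "padic_residue a = 0" by (simp add: padic_residue_def)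
next
  let ?p = "int CARD('p)"
  have p: "?p > 0" using one_less_CARD_prime [where 'p = 'p] by simp
  assume "padic_residue a = 0"
  then have "Rep_padic_int a 1 mod ?p = 0"
    unfolding padic_residue_def by transfer simp
  then have dvd: "?p dvd Rep_padic_int a (Suc n)" for n
    using Rep_padic_int_mod [of a 1 n] by (simp add: mod_eq_0_iff_dvd dvd_mod_iff)
  define f where "f n = Rep_padic_int a (Suc n) div ?p" for n
  have pf: "?p * f n = Rep_padic_int a (Suc n)" for n
    using dvd [of n] by (simp add: f_def)
  have "f (Suc n) mod ?p ^ n = f n" for n
  proof -
    have "?p * (f (Suc n) mod ?p ^ n) = (?p * f (Suc n)) mod ?p ^ Suc n"
      by (simp only: mult_mod_right power_Suc)
    also have "\<dots> = ?p * f n"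
      using Rep_padic_int_mod [of a "Suc n" 1] by (simp add: pf del: power_Suc)
    finally show ?thesis using p by simp
  qed
  then have Rep_f: "Rep_padic_int (Abs_padic_int f :: 'p padic_int) = f"
    by (intro Abs_padic_int_inverse) simp
  have "a = of_nat CARD('p) * (Abs_padic_int f :: 'p padic_int)"
  proof (subst Rep_padic_int_inject [symmetric], rule ext)
    fix n
    have "Rep_padic_int (of_nat CARD('p) * (Abs_padic_int f :: 'p padic_int)) n
        = (?p mod ?p ^ n * f n) mod ?p ^ n"
      by (simp add: times_padic_int.rep_eq Rep_of_nat_padic_int Rep_f)
    also have "\<dots> = (?p * f n) mod ?p ^ n" by (simp only: mod_mult_left_eq)
    also have "\<dots> = Rep_padic_int a n"
      using Rep_padic_int_mod [of a n 1] by (simp add: pf)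
    finally show "Rep_padic_int a n = Rep_padic_int (of_nat CARD('p) * (Abs_padic_int f :: 'p padic_int)) n" ..
  qed
  then show "of_nat CARD('p) dvd a" by (rule dvdI)
qed


section \<open>The special linear group of degree 2\<close>

text \<open>The tuple \<open>(a, b, c, d)\<close> stands for the matrix with rows \<open>(a, b)\<close> and \<open>(c, d)\<close>.\<close>

definition SL2 :: "('r, 'm) ring_scheme \<Rightarrow> ('r \<times> 'r \<times> 'r \<times> 'r) monoid" where
  "SL2 R = \<lparr>
     carrier = {(a, b, c, d). a \<in> carrier R \<and> b \<in> carrier R \<and> c \<in> carrier R \<and> d \<in> carrier R \<and>
       a \<otimes>\<^bsub>R\<^esub> d \<ominus>\<^bsub>R\<^esub> b \<otimes>\<^bsub>R\<^esub> c = \<one>\<^bsub>R\<^esub>},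
     monoid.mult = (\<lambda>(a, b, c, d) (a', b', c', d').
       (a \<otimes>\<^bsub>R\<^esub> a' \<oplus>\<^bsub>R\<^esub> b \<otimes>\<^bsub>R\<^esub> c', a \<otimes>\<^bsub>R\<^esub> b' \<oplus>\<^bsub>R\<^esub> b \<otimes>\<^bsub>R\<^esub> d',
        c \<otimes>\<^bsub>R\<^esub> a' \<oplus>\<^bsub>R\<^esub> d \<otimes>\<^bsub>R\<^esub> c', c \<otimes>\<^bsub>R\<^esub> b' \<oplus>\<^bsub>R\<^esub> d \<otimes>\<^bsub>R\<^esub> d')),
     one = (\<one>\<^bsub>R\<^esub>, \<zero>\<^bsub>R\<^esub>, \<zero>\<^bsub>R\<^esub>, \<one>\<^bsub>R\<^esub>)\<rparr>"

definition SL2_T :: "('r, 'm) ring_scheme \<Rightarrow> 'r \<times> 'r \<times> 'r \<times> 'r" where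
  "SL2_T R = (\<one>\<^bsub>R\<^esub>, \<one>\<^bsub>R\<^esub>, \<zero>\<^bsub>R\<^esub>, \<one>\<^bsub>R\<^esub>)"

definition SL2_S :: "('r, 'm) ring_scheme \<Rightarrow> 'r \<times> 'r \<times> 'r \<times> 'r" where
  "SL2_S R = (\<zero>\<^bsub>R\<^esub>, \<ominus>\<^bsub>R\<^esub> \<one>\<^bsub>R\<^esub>, \<one>\<^bsub>R\<^esub>, \<zero>\<^bsub>R\<^esub>)"

lemma (in cring) SL2_is_group: "group (SL2 R)"
proof (rule groupI)
  fix g h assume "g \<in> carrier (SL2 R)" "h \<in> carrier (SL2 R)"
  then obtain a b c d a' b' c' d' where g: "g = (a, b, c, d)" and h: "h = (a', b', c', d')"
    and mem: "a \<in> carrier R" "b \<in> carrier R" "c \<in> carrier R" "d \<in> carrier R"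
      "a' \<in> carrier R" "b' \<in> carrier R" "c' \<in> carrier R" "d' \<in> carrier R"
    and det: "a \<otimes> d \<ominus> b \<otimes> c = \<one>" "a' \<otimes> d' \<ominus> b' \<otimes> c' = \<one>"
    by (auto simp: SL2_def)
  have "(a \<otimes> a' \<oplus> b \<otimes> c') \<otimes> (c \<otimes> b' \<oplus> d \<otimes> d') \<ominus> (a \<otimes> b' \<oplus> b \<otimes> d') \<otimes> (c \<otimes> a' \<oplus> d \<otimes> c')
      = (a \<otimes> d \<ominus> b \<otimes> c) \<otimes> (a' \<otimes> d' \<ominus> b' \<otimes> c')"
    using mem by algebra
  then show "g \<otimes>\<^bsub>SL2 R\<^esub> h \<in> carrier (SL2 R)"
    using mem det by (simp add: SL2_def g h)
next
  show "\<one>\<^bsub>SL2 R\<^esub> \<in> carrier (SL2 R)"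
    by (simp add: SL2_def minus_eq)
next
  fix x y z assume "x \<in> carrier (SL2 R)" "y \<in> carrier (SL2 R)" "z \<in> carrier (SL2 R)"
  then show "x \<otimes>\<^bsub>SL2 R\<^esub> y \<otimes>\<^bsub>SL2 R\<^esub> z = x \<otimes>\<^bsub>SL2 R\<^esub> (y \<otimes>\<^bsub>SL2 R\<^esub> z)"
    by (auto simp: SL2_def l_distr r_distr m_assoc a_ac)
next
  fix x assume "x \<in> carrier (SL2 R)"
  then show "\<one>\<^bsub>SL2 R\<^esub> \<otimes>\<^bsub>SL2 R\<^esub> x = x"
    by (auto simp: SL2_def)
next
  fix x assume "x \<in> carrier (SL2 R)"
  then obtain a b c d where x: "x = (a, b, c, d)"
    and mem: "a \<in> carrier R" "b \<in> carrier R" "c \<in> carrier R" "d \<in> carrier R"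
    and det: "a \<otimes> d \<ominus> b \<otimes> c = \<one>"
    by (auto simp: SL2_def)
  have 1: "d \<otimes> a \<oplus> \<ominus> b \<otimes> c = \<one>" "\<ominus> c \<otimes> b \<oplus> a \<otimes> d = \<one>" "d \<otimes> a \<ominus> \<ominus> b \<otimes> \<ominus> c = \<one>"
    unfolding det [symmetric] using mem by algebra+
  have 2: "d \<otimes> b \<oplus> \<ominus> b \<otimes> d = \<zero>" "\<ominus> c \<otimes> a \<oplus> a \<otimes> c = \<zero>"
    using mem by algebra+
  show "\<exists>y\<in>carrier (SL2 R). y \<otimes>\<^bsub>SL2 R\<^esub> x = \<one>\<^bsub>SL2 R\<^esub>"
    by (rule bexI [of _ "(d, \<ominus> b, \<ominus> c, a)"]) (use mem 1 2 in \<open>simp_all add: SL2_def x\<close>)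
qed


section \<open>The Weil representation and its reduction\<close>

definition primitive_root_of_unity :: "nat \<Rightarrow> 'k::field \<Rightarrow> bool" where
  "primitive_root_of_unity N z \<longleftrightarrow> 1 \<le> N \<and> z ^ N = 1 \<and> (\<forall>k. 1 \<le> k \<and> k < N \<longrightarrow> z ^ k \<noteq> 1)"

text \<open>The additive character \<open>k / N \<mapsto> \<zeta> ^ k\<close>, only meaningful on classes annihilated by \<open>N\<close>.\<close>

definition exp_root :: "nat \<Rightarrow> 'k::field \<Rightarrow> rat_mod_int \<Rightarrow> 'k" where
  "exp_root N z q = z ^ (THE k. k < N \<and> q = rat_class (of_nat k / of_nat N))"

text \<open>
  The coordinate space \<open>'k ^ 'a\<close> is the underlying vector space of the group algebra of \<open>'a\<close>,
  and \<open>axis x 1\<close> is its basis vector indexed by \<open>x\<close>.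
\<close>

definition is_weil_representation ::
  "('a::{finite,ab_group_add} \<Rightarrow> rat_mod_int) \<Rightarrow> 'k::field \<Rightarrow>
   (int set \<times> int set \<times> int set \<times> int set \<Rightarrow> ('k, 'a) vec \<Rightarrow> ('k, 'a) vec) \<Rightarrow> bool" where
  "is_weil_representation Q z \<rho> \<longleftrightarrow>
     (let N = level Q;
          R = ZFact (int N);
          e = exp_root N z;
          w = inverse (of_nat CARD('a)) * (\<Sum>x\<in>UNIV. e (- Q x))
      in group_action (SL2 R) UNIV \<rho> \<and>
         (\<forall>g\<in>carrier (SL2 R). Vector_Spaces.linear (*s) (*s) (\<rho> g)) \<and>
         (\<forall>x. \<rho> (SL2_T R) (axis x 1) = e (Q x) *s axis x 1) \<and>
         (\<forall>x. \<rho> (SL2_S R) (axis x 1) = w *s (\<Sum>y\<in>UNIV. e (- polar Q x y) *s axis y 1)))"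

definition lattice_embedding :: "'p::prime_card padic_int ^ 'a::finite \<Rightarrow> 'p padic ^ 'a" where
  "lattice_embedding u = (\<chi> x. padic_of_int (u $ x))"

definition lattice_reduction :: "'p::prime_card padic_int ^ 'a::finite \<Rightarrow> 'p mod_ring ^ 'a" where
  "lattice_reduction u = (\<chi> x. padic_residue (u $ x))"

text \<open>
  For a linear map \<open>f\<close> that preserves the lattice, the induced map sends the reduction of a
  lattice vector to the reduction of its image under \<open>f\<close>.
\<close>

definition induced_map ::
  "('p::prime_card padic ^ 'a::finite \<Rightarrow> 'p padic ^ 'a) \<Rightarrow> 'p mod_ring ^ 'a \<Rightarrow> 'p mod_ring ^ 'a" where
  "induced_map f v = (THE v'. \<exists>u u'. lattice_reduction u = v \<and>
     lattice_embedding u' = f (lattice_embedding u) \<and> v' = lattice_reduction u')"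

definition fixed_vectors :: "('g, 'm) monoid_scheme \<Rightarrow> ('g \<Rightarrow> 'v \<Rightarrow> 'v) \<Rightarrow> 'v set" where
  "fixed_vectors G \<rho> = {v. \<forall>g\<in>carrier G. \<rho> g v = v}"

end

theory Submission
  imports Defs "HOL-Algebra.Sylow" "HOL-Number_Theory.Number_Theory"
begin

text \<open>
  The congruence \<open>\<ell> = 1 (mod N)\<close> makes \<open>\<ell>\<close> larger than \<open>p + 1\<close> for every prime divisor \<open>p\<close> of \<open>N\<close>,
  the pair \<open>(2, 3)\<close> being the only exception. Hence an element of order \<open>\<ell>\<close> of
  \<open>SL\<^sub>2(\<int>/N\<int>)\<close> would fix all \<open>p + 1\<close> lines of each \<open>\<F>\<^sub>p\<^sup>2\<close>, which forces it to be
  trivial, and \<open>\<ell>\<close> does not divide the group order. So averaging over the group is a projection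
  defined over \<open>\<int>\<^sub>\<ell>\<close> onto the fixed vectors, compatibly with reduction, and the rank of a
  projection does not change under reduction.
\<close>

section \<open>Integer matrices of prime order modulo \<open>N\<close>\<close>

text \<open>Two gaps remain between fixed lines and a trivial element. A fixed line only yields an
  eigenvector; its eigenvalue disappears in the power p - 1, an exponent that l does not divide. And
  N may contain prime powers: these are reached one factor p at a time, where the deviation from the
  identity is a vector modulo p annihilated by l, hence zero. To pass between moduli and to divide
  by divisors of N, matrices and vectors keep integer entries and only congruences are imposed. The
  exception (2, 3) is a real obstacle to averaging: SL_2(Z/2) has order 6. Averaging over Z_l also
  needs the whole group to preserve the lattice, although only T and S are given by formulas. Their
  entries are integral because roots of unity are l-adic integers and because |A| is prime to l: by
  nondegeneracy N annihilates A, so l = 1 (mod N) acts on A as the identity.\<close>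

definition matvec :: "int \<times> int \<times> int \<times> int \<Rightarrow> int \<times> int \<Rightarrow> int \<times> int" where
  "matvec = (\<lambda>(a, b, c, d) (x, y). (a * x + b * y, c * x + d * y))"

definition scale_vec :: "int \<Rightarrow> int \<times> int \<Rightarrow> int \<times> int" where
  "scale_vec k v = (k * fst v, k * snd v)"

definition cong_vec :: "int \<Rightarrow> int \<times> int \<Rightarrow> int \<times> int \<Rightarrow> bool" where
  "cong_vec m u v \<longleftrightarrow> [fst u = fst v] (mod m) \<and> [snd u = snd v] (mod m)"

lemma cong_vec_refl [simp]: "cong_vec m u u"
  by (simp add: cong_vec_def)

lemma cong_vec_sym: "cong_vec m u v \<Longrightarrow> cong_vec m v u"
  by (simp add: cong_vec_def cong_sym)

lemma cong_vec_trans [trans]: "cong_vec m u v \<Longrightarrow> cong_vec m v w \<Longrightarrow> cong_vec m u w"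
  by (auto simp: cong_vec_def intro: cong_trans)

lemma cong_vec_add: "cong_vec m u v \<Longrightarrow> cong_vec m u' v' \<Longrightarrow> cong_vec m (u + u') (v + v')"
  by (simp add: cong_vec_def cong_add)

lemma cong_vec_scale: "cong_vec m u v \<Longrightarrow> cong_vec m (scale_vec k u) (scale_vec k v)"
  by (simp add: cong_vec_def scale_vec_def cong_mult)

lemma cong_vec_scale_left: "[j = k] (mod m) \<Longrightarrow> cong_vec m (scale_vec j u) (scale_vec k u)"
  by (simp add: cong_vec_def scale_vec_def cong_mult)

lemma scale_vec_scale_vec [simp]: "scale_vec j (scale_vec k v) = scale_vec (j * k) v"
  by (simp add: scale_vec_def)

lemma scale_vec_one [simp]: "scale_vec 1 v = v"
  by (simp add: scale_vec_def)

lemma scale_vec_zero_left [simp]: "scale_vec 0 v = 0"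
  by (simp add: scale_vec_def zero_prod_def)

lemma matvec_add: "matvec A (u + v) = matvec A u + matvec A v"
  by (cases A; cases u; cases v) (simp add: matvec_def algebra_simps)

lemma matvec_scale: "matvec A (scale_vec k v) = scale_vec k (matvec A v)"
  by (cases A; cases v) (simp add: matvec_def scale_vec_def algebra_simps)

lemma cong_vec_matvec: "cong_vec m u v \<Longrightarrow> cong_vec m (matvec A u) (matvec A v)"
  by (cases A; cases u; cases v) (simp add: matvec_def cong_vec_def cong_add cong_mult)

lemma iter_iter: "(f ^^ m) ((f ^^ n) x) = (f ^^ (m + n)) x"
  by (simp add: funpow_add)

lemma iter_matvec_scale: "(matvec A ^^ n) (scale_vec k v) = scale_vec k ((matvec A ^^ n) v)"
  by (induction n) (simp_all add: matvec_scale)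

lemma iter_matvec_add: "(matvec A ^^ n) (u + v) = (matvec A ^^ n) u + (matvec A ^^ n) v"
  by (induction n) (simp_all add: matvec_add)

lemma cong_vec_iter_matvec: "cong_vec m u v \<Longrightarrow> cong_vec m ((matvec A ^^ n) u) ((matvec A ^^ n) v)"
  by (induction n) (simp_all add: cong_vec_matvec)

lemma cong_vec_iter_period:
  assumes "cong_vec m ((matvec A ^^ l) u) u"
  shows "cong_vec m ((matvec A ^^ (l * q)) u) u"
proof (induction q)
  case (Suc q)
  have "(matvec A ^^ (l * Suc q)) u = (matvec A ^^ l) ((matvec A ^^ (l * q)) u)"
    by (simp add: funpow_add)
  also have "cong_vec m \<dots> ((matvec A ^^ l) u)" by (rule cong_vec_iter_matvec [OF Suc])
  finally show ?case using assms cong_vec_trans by blast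
qed simp

text \<open>Here \<open>i\<close> and \<open>i'\<close> are the inverses of \<open>x\<close> and
  \<open>x'\<close>, so the last assumption compares the slopes y/x and y'/x'. The factor is k =
  x'/x, that is \<open>x' * i\<close>.\<close>

lemma proportional_if_same_ratio:
  fixes p :: int
  assumes "prime p" "\<not> p dvd x" "\<not> p dvd x'"
    "[x * i = 1] (mod p)" "[x' * i' = 1] (mod p)" "[y * i = y' * i'] (mod p)"
  shows "\<exists>k. coprime k p \<and> cong_vec p (x', y') (scale_vec k (x, y))"
proof (intro exI conjI)
  have i: "coprime i p" using assms(4)
    by (metis coprime_iff_invertible_int mult.commute)
  show "coprime (x' * i) p"
    using assms(1,3) i by (simp add: prime_imp_coprime coprime_commute)
  have "[x' * i * x = x' * (x * i)] (mod p)" by (simp add: mult_ac)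
  also have "[x' * (x * i) = x' * 1] (mod p)" by (intro cong_mult assms cong_refl)
  finally have 1: "[x' = x' * i * x] (mod p)" by (simp add: cong_sym)
  have "[x' * i * y = x' * (y * i)] (mod p)" by (simp add: mult_ac)
  also have "[x' * (y * i) = x' * (y' * i')] (mod p)" by (intro cong_mult assms cong_refl)
  also have "x' * (y' * i') = y' * (x' * i')" by (simp add: mult_ac)
  also have "[y' * (x' * i') = y' * 1] (mod p)" by (intro cong_mult assms cong_refl)
  finally have 2: "[y' = x' * i * y] (mod p)" by (simp add: cong_sym)
  show "cong_vec p (x', y') (scale_vec (x' * i) (x, y))"
    using 1 2 by (simp add: cong_vec_def scale_vec_def)
qed

lemma projective_line_classes:
  fixes p :: nat
  assumes p: "prime p"
  shows "\<exists>f :: int \<times> int \<Rightarrow> nat. (\<forall>v. f v \<le> p) \<and>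
    (\<forall>u v. \<not> cong_vec p u 0 \<longrightarrow> \<not> cong_vec p v 0 \<longrightarrow> f u = f v \<longrightarrow>
      (\<exists>k. coprime k (int p) \<and> cong_vec p v (scale_vec k u)))"
proof -
  have pi: "prime (int p)" using p by simp
  have "\<exists>i. \<not> int p dvd x \<longrightarrow> [x * i = 1] (mod int p)" for x
    using pi by (metis coprime_commute coprime_iff_invertible_int prime_imp_coprime)
  then obtain rec where rec: "\<not> int p dvd x \<Longrightarrow> [x * rec x = 1] (mod int p)" for x
    by metis
  define f where "f v = (if int p dvd fst v then p else nat (snd v * rec (fst v) mod int p))"
    for v :: "int \<times> int"
  have p0: "int p > 0" using p prime_gt_0_nat by simp
  have lt: "nat (z mod int p) < p" for z
    using p0 by (metis nat_less_iff pos_mod_bound pos_mod_sign)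
  have "f v \<le> p" for v using lt by (simp add: f_def less_imp_le)
  moreover have "\<exists>k. coprime k (int p) \<and> cong_vec p v (scale_vec k u)"
    if nz: "\<not> cong_vec p u 0" "\<not> cong_vec p v 0" and eq: "f u = f v" for u v
  proof (cases "int p dvd fst u")
    case True
    then have v: "int p dvd fst v" using eq lt by (auto simp: f_def split: if_splits) (metis less_irrefl)
    have "\<not> int p dvd snd u" "\<not> int p dvd snd v"
      using nz True v by (auto simp: cong_vec_def cong_0_iff)
    \<comment> \<open>On the line at infinity the second coordinate is a unit, so the coordinates
      are swapped; both slopes are then 0.\<close>
    then obtain k where "coprime k (int p)" "cong_vec p (snd v, fst v) (scale_vec k (snd u, fst u))"
      using proportional_if_same_ratio [OF pi, of "snd u" "snd v" "rec (snd u)" "rec (snd v)" "fst u" "fst v"]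
        rec True v by (auto simp: cong_def dvd_imp_mod_0)
    then show ?thesis by (auto simp: cong_vec_def scale_vec_def)
  next
    case False
    then have v: "\<not> int p dvd fst v" using eq lt by (auto simp: f_def split: if_splits) (metis less_irrefl)
    have "snd u * rec (fst u) mod int p = snd v * rec (fst v) mod int p"
      using eq False v p0 by (simp add: f_def nat_eq_iff)
    then show ?thesis
      using proportional_if_same_ratio [OF pi False v rec rec, of "snd u" "snd v"] False v
      by (simp add: cong_def)
  qed
  ultimately show ?thesis by blast
qed

text \<open>
  There are only \<open>p + 1 < l\<close> lines in \<open>\<F>\<^sub>p\<^sup>2\<close>, so two of the first \<open>l\<close> iterates of \<open>u\<close> span the
  same line; hence \<open>u\<close> is an eigenvector of a power of \<open>A\<close> whose exponent is coprime to \<open>l\<close>.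
\<close>

lemma fixed_mod_prime:
  fixes p l :: nat
  assumes p: "prime p" and l: "prime l" and less: "p + 1 < l"
    and per: "cong_vec p ((matvec A ^^ l) u) u"
  shows "cong_vec p (matvec A u) u"
proof (cases "cong_vec p u 0")
  case True
  have "cong_vec p (matvec A u) (matvec A 0)" using True by (rule cong_vec_matvec)
  also have "matvec A 0 = 0" by (cases A) (simp add: matvec_def zero_prod_def)
  also have "cong_vec p 0 u" using True by (rule cong_vec_sym)
  finally show ?thesis .
next
  case False
  let ?F = "matvec A"
  have zero: "(?F ^^ n) 0 = 0" for n
    using iter_matvec_scale [where A = A and n = n and k = 0 and v = 0] by simp
  have nz: "\<not> cong_vec p ((?F ^^ i) u) 0" if "i \<le> l" for i
  proof
    assume "cong_vec p ((?F ^^ i) u) 0"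
    then have "cong_vec p ((?F ^^ (l - i)) ((?F ^^ i) u)) ((?F ^^ (l - i)) 0)"
      by (rule cong_vec_iter_matvec)
    then have "cong_vec p ((?F ^^ l) u) 0"
      using that by (simp add: zero iter_iter)
    then show False using False per cong_vec_sym cong_vec_trans by blast
  qed
  obtain f :: "int \<times> int \<Rightarrow> nat" where f: "\<And>v. f v \<le> p"
    "\<And>u v. \<not> cong_vec p u 0 \<Longrightarrow> \<not> cong_vec p v 0 \<Longrightarrow> f u = f v \<Longrightarrow>
      \<exists>k. coprime k (int p) \<and> cong_vec p v (scale_vec k u)"
    using projective_line_classes [OF p] by blast
  have "card ((\<lambda>i. f ((?F ^^ i) u)) ` {..<l}) \<le> card {..p}"
    by (intro card_mono image_subsetI) (simp_all only: finite_atMost atMost_iff f(1))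
  then have "\<not> inj_on (\<lambda>i. f ((?F ^^ i) u)) {..<l}"
    using less by (intro notI) (simp add: card_image)
  then obtain i j where ij: "i < j" "j < l" "f ((?F ^^ i) u) = f ((?F ^^ j) u)"
    unfolding inj_on_def by (metis lessThan_iff linorder_neqE_nat)
  obtain c where c: "coprime c (int p)" "cong_vec p ((?F ^^ j) u) (scale_vec c ((?F ^^ i) u))"
    using f(2) [OF nz nz ij(3)] ij by auto
  \<comment> \<open>Cancelling i iterations without inverting \<open>A\<close>: l - i further
    iterations turn i into the period l, which acts trivially on \<open>u\<close>, and j into k + l.
    So \<open>u\<close> is an eigenvector of the k-th iterate with eigenvalue
    \<open>c\<close>.\<close>
  define k where "k = j - i"
  have eq: "l - i + j = k + l" using ij by (simp add: k_def)
  have "cong_vec p ((?F ^^ (l - i)) ((?F ^^ j) u)) ((?F ^^ (l - i)) (scale_vec c ((?F ^^ i) u)))"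
    by (rule cong_vec_iter_matvec [OF c(2)])
  moreover have "(?F ^^ (l - i)) ((?F ^^ j) u) = (?F ^^ k) ((?F ^^ l) u)"
    using eq by (simp add: iter_iter)
  moreover have "(?F ^^ (l - i)) (scale_vec c ((?F ^^ i) u)) = scale_vec c ((?F ^^ l) u)"
    using ij by (simp add: iter_matvec_scale iter_iter)
  ultimately have "cong_vec p ((?F ^^ k) ((?F ^^ l) u)) (scale_vec c ((?F ^^ l) u))" by simp
  then have k: "cong_vec p ((?F ^^ k) u) (scale_vec c u)"
    using cong_vec_iter_matvec [OF per, where A = A and n = k] cong_vec_scale [OF per, of c]
      cong_vec_sym cong_vec_trans by blast
  have kn: "cong_vec p ((?F ^^ (k * n)) u) (scale_vec (c ^ n) u)" for n
  proof (induction n)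
    case (Suc n)
    have "(?F ^^ (k * Suc n)) u = (?F ^^ k) ((?F ^^ (k * n)) u)" by (simp add: funpow_add)
    also have "cong_vec p \<dots> ((?F ^^ k) (scale_vec (c ^ n) u))" by (rule cong_vec_iter_matvec [OF Suc])
    also have "(?F ^^ k) (scale_vec (c ^ n) u) = scale_vec (c ^ n) ((?F ^^ k) u)"
      by (rule iter_matvec_scale)
    also have "cong_vec p \<dots> (scale_vec (c ^ n) (scale_vec c u))" by (rule cong_vec_scale [OF k])
    finally show ?case by (simp add: mult.commute)
  qed simp
  \<comment> \<open>By Fermat the eigenvalue becomes 1 in the power p - 1, so K iterations fix
    \<open>u\<close>. Both 0 < k < l and 0 < p - 1 < l, so K is invertible modulo l; with K m = 1 +
    l q, iterating K m times gives both \<open>u\<close> and the single image of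
    \<open>u\<close>.\<close>
  define K where "K = k * (p - 1)"
  have "[c ^ (p - 1) = 1] (mod int p)"
    using residues.euler_theorem [of "int p" c] c(1) p prime_gt_1_nat [OF p]
    by (simp add: residues_def totient_prime)
  then have "cong_vec p (scale_vec (c ^ (p - 1)) u) (scale_vec 1 u)" by (rule cong_vec_scale_left)
  then have K: "cong_vec p ((?F ^^ K) u) u"
    using kn [of "p - 1"] by (simp add: K_def) (rule cong_vec_trans)
  have "coprime K l"
    using l p ij less prime_gt_1_nat [OF p] unfolding K_def k_def
    by (simp add: coprime_commute [of _ l])
      (auto intro!: prime_imp_coprime simp: nat_dvd_not_less)
  then obtain m where "[K * m = Suc 0] (mod l)" using cong_solve_coprime_nat by blast
  then have "K * m = l * (K * m div l) + 1"
    using prime_gt_1_nat [OF l] by (metis One_nat_def cong_def mod_less mult_div_mod_eq)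
  then have "(?F ^^ (K * m)) u = ?F ((?F ^^ (l * (K * m div l))) u)"
    by (metis Suc_eq_plus1 comp_apply funpow.simps(2))
  moreover have "cong_vec p (?F ((?F ^^ (l * (K * m div l))) u)) (?F u)"
    by (intro cong_vec_matvec cong_vec_iter_period per)
  moreover have "cong_vec p ((?F ^^ (K * m)) u) u" by (rule cong_vec_iter_period [OF K])
  ultimately show ?thesis using cong_vec_sym cong_vec_trans by metis
qed

text \<open>Induction over the divisors M of N, one prime factor at a time. If A v - v = M u, then
  A^n v - v = M s with s = n u modulo p, by telescoping, since A is already trivial modulo p. For n
  = l the left side vanishes modulo p M, so p divides l u, hence u, and M improves to p M.\<close>

lemma fixed_mod_if_iter_fixed:
  fixes N l :: nat
  assumes N: "N > 0" and l: "prime l" and less: "\<And>p. prime p \<Longrightarrow> p dvd N \<Longrightarrow> p + 1 < l"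
    and per: "\<And>v. cong_vec N ((matvec A ^^ l) v) v"
  shows "cong_vec N (matvec A v) v"
proof -
  let ?F = "matvec A"
  have "M dvd N \<Longrightarrow> \<exists>u. ?F v - v = scale_vec (int M) u" for M
  proof (induction M rule: prime_divisors_induct)
    case zero
    then show ?case using N by simp
  next
    case (unit M)
    then show ?case by (intro exI [of _ "?F v - v"]) simp
  next
    case (factor p M)
    then obtain u where u: "?F v - v = scale_vec (int M) u" by (auto dest: dvd_mult_right)
    have p: "p dvd N" using factor by (auto dest: dvd_mult_left)
    have "M > 0" using factor N by (auto intro!: Nat.gr0I)
    have fixed: "cong_vec p (?F w) w" for w
    proof (rule fixed_mod_prime)
      show "cong_vec p ((?F ^^ l) w) w"
        using per [of w] p by (auto simp: cong_vec_def intro: cong_dvd_modulus)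
    qed (use factor p l less in auto)
    have "\<exists>s. (?F ^^ n) v - v = scale_vec (int M) s \<and> cong_vec p s (scale_vec (int n) u)" for n
    proof (induction n)
      case 0
      show ?case by (intro exI [of _ 0]) (simp add: scale_vec_def zero_prod_def)
    next
      case (Suc n)
      then obtain s where s: "(?F ^^ n) v - v = scale_vec (int M) s" "cong_vec p s (scale_vec (int n) u)"
        by blast
      have "(?F ^^ n) v = v + scale_vec (int M) s" using s by (simp add: algebra_simps)
      then have "(?F ^^ Suc n) v - v = scale_vec (int M) (?F s) + (?F v - v)"
        by (simp add: matvec_add matvec_scale)
      also have "\<dots> = scale_vec (int M) (?F s + u)"
        by (simp add: u scale_vec_def algebra_simps)
      moreover have "cong_vec p (?F s + u) (scale_vec (int n) u + u)"
        using fixed [of s] s(2) by (intro cong_vec_add cong_vec_refl) (rule cong_vec_trans)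
      moreover have "scale_vec (int n) u + u = scale_vec (int (Suc n)) u"
        by (cases u) (simp add: scale_vec_def algebra_simps)
      ultimately show ?case by (intro exI [of _ "?F s + u"]) simp
    qed
    then obtain s where s: "(?F ^^ l) v - v = scale_vec (int M) s" "cong_vec p s (scale_vec (int l) u)"
      by blast
    have "int (p * M) dvd fst ((?F ^^ l) v - v) \<and> int (p * M) dvd snd ((?F ^^ l) v - v)"
      using per [of v] factor(3) by (auto simp: cong_vec_def cong_iff_dvd_diff
          intro: dvd_trans [of "int p * int M" "int N"] simp flip: of_nat_mult)
    then have "int p dvd fst s \<and> int p dvd snd s"
      using \<open>M > 0\<close> by (auto simp: s(1) scale_vec_def mult.commute)
    then have "int p dvd int l * fst u \<and> int p dvd int l * snd u"
      using s(2) by (auto simp: cong_vec_def scale_vec_def dest: cong_dvd_iff)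
    moreover have "coprime p l"
      using factor(1) l less [OF _ p] by (intro primes_coprime) auto
    ultimately have "int p dvd fst u \<and> int p dvd snd u"
      by (simp add: coprime_dvd_mult_right_iff)
    then obtain x y where "fst u = int p * x" "snd u = int p * y" by (auto elim!: dvdE)
    then show ?case
      by (intro exI [of _ "(x, y)"]) (simp add: u, simp add: scale_vec_def)
  qed
  from this [of N] obtain u where u: "?F v - v = scale_vec (int N) u" by auto
  then have "fst (?F v) - fst v = int N * fst u" "snd (?F v) - snd v = int N * snd u"
    by (metis fst_diff snd_diff scale_vec_def fst_conv snd_conv)+
  then show ?thesis by (simp add: cong_vec_def cong_iff_dvd_diff)
qed

section \<open>The group \<open>SL\<^sub>2(\<int>/N\<int>)\<close>\<close>

text \<open>Contrapositive of Cauchy's theorem, obtained from Sylow's theorem with exponent 1; the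
  cofactor \<open>m\<close> may still be divisible by \<open>l\<close>. The order of the subgroup
  kills each of its elements.\<close>

lemma not_prime_dvd_order:
  assumes "group G" "finite (carrier G)" "prime l"
    and "\<And>g. g \<in> carrier G \<Longrightarrow> g [^]\<^bsub>G\<^esub> l = \<one>\<^bsub>G\<^esub> \<Longrightarrow> g = \<one>\<^bsub>G\<^esub>"
  shows "\<not> l dvd order G"
proof
  interpret group G by fact
  assume "l dvd order G"
  then obtain m where "order G = l ^ 1 * m" by auto
  then obtain H where H: "subgroup H G" "card H = l ^ 1"
    using sylow_thm assms by metis
  interpret H: subgroup H G by fact
  have "card H > 1" using H assms(3) prime_gt_1_nat by simp
  then have "\<not> H \<subseteq> {\<one>\<^bsub>G\<^esub>}"
    using card_mono [of "{\<one>\<^bsub>G\<^esub>}" H] by auto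
  then obtain h where h: "h \<in> H" "h \<noteq> \<one>\<^bsub>G\<^esub>" by blast
  have "h [^]\<^bsub>G\<lparr>carrier := H\<rparr>\<^esub> order (G\<lparr>carrier := H\<rparr>) = \<one>\<^bsub>G\<lparr>carrier := H\<rparr>\<^esub>"
    using group.pow_order_eq_1 [OF H.subgroup_is_group [OF assms(1)]] h by simp
  then have "h [^]\<^bsub>G\<^esub> l = \<one>\<^bsub>G\<^esub>" using H(2) by (simp add: order_def nat_pow_consistent [symmetric])
  then show False using assms(4) h H.subset by auto
qed

definition residue_mat :: "nat \<Rightarrow> int \<times> int \<times> int \<times> int \<Rightarrow> int set \<times> int set \<times> int set \<times> int set" where
  "residue_mat N = (\<lambda>(a, b, c, d). (ZMod (int N) a, ZMod (int N) b, ZMod (int N) c, ZMod (int N) d))"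

lemma ZFact_ops:
  "ZMod k a \<oplus>\<^bsub>ZFact k\<^esub> ZMod k b = ZMod k (a + b)"
  "ZMod k a \<otimes>\<^bsub>ZFact k\<^esub> ZMod k b = ZMod k (a * b)"
  "\<one>\<^bsub>ZFact k\<^esub> = ZMod k 1" "\<zero>\<^bsub>ZFact k\<^esub> = ZMod k 0"
  "\<ominus>\<^bsub>ZFact k\<^esub> ZMod k a = ZMod k (- a)"
  "carrier (ZFact k) = range (ZMod k)"
proof -
  interpret I: ideal "Idl\<^bsub>\<Z>\<^esub> {k}" \<Z> by (rule int.genideal_ideal) simp
  interpret h: ring_hom_ring \<Z> "ZFact k" "ZMod k"
    using I.rcos_ring_hom_ring by (simp add: ZFact_def ZMod_def [abs_def])
  show "ZMod k a \<oplus>\<^bsub>ZFact k\<^esub> ZMod k b = ZMod k (a + b)" using h.hom_add [of a b] by simp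
  show "ZMod k a \<otimes>\<^bsub>ZFact k\<^esub> ZMod k b = ZMod k (a * b)" using h.hom_mult [of a b] by simp
  show "\<one>\<^bsub>ZFact k\<^esub> = ZMod k 1" using h.hom_one by simp
  show "\<zero>\<^bsub>ZFact k\<^esub> = ZMod k 0" using h.hom_zero by simp
  show "\<ominus>\<^bsub>ZFact k\<^esub> ZMod k a = ZMod k (- a)" using h.hom_a_inv [of a] by simp
  show "carrier (ZFact k) = range (ZMod k)"
    by (auto simp: ZFact_defs A_RCOSETS_def' ZMod_def)
qed

lemma ZFact_minus: "ZMod k a \<ominus>\<^bsub>ZFact k\<^esub> ZMod k b = ZMod k (a - b)"
  by (simp add: a_minus_def ZFact_ops)

lemma ZMod_eq_iff_cong: "ZMod k a = ZMod k b \<longleftrightarrow> [a = b] (mod k)"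
  by (simp add: ZMod_eq_mod cong_def)

lemma SL2_ZFact_mult:
  "residue_mat N (a, b, c, d) \<otimes>\<^bsub>SL2 (ZFact (int N))\<^esub> residue_mat N (a', b', c', d')
    = residue_mat N (a * a' + b * c', a * b' + b * d', c * a' + d * c', c * b' + d * d')"
  by (simp add: residue_mat_def SL2_def ZFact_ops)

lemma SL2_ZFact_one: "\<one>\<^bsub>SL2 (ZFact (int N))\<^esub> = residue_mat N (1, 0, 0, 1)"
  by (simp add: residue_mat_def SL2_def ZFact_ops)

lemma SL2_T_ZFact: "SL2_T (ZFact (int N)) = residue_mat N (1, 1, 0, 1)"
  by (simp add: residue_mat_def SL2_T_def ZFact_ops)

lemma SL2_S_ZFact: "SL2_S (ZFact (int N)) = residue_mat N (0, -1, 1, 0)"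
  by (simp add: residue_mat_def SL2_S_def ZFact_ops)

lemma residue_mat_eq_iff:
  "residue_mat N (a, b, c, d) = residue_mat N (a', b', c', d') \<longleftrightarrow>
    [a = a'] (mod int N) \<and> [b = b'] (mod int N) \<and> [c = c'] (mod int N) \<and> [d = d'] (mod int N)"
  by (simp add: residue_mat_def ZMod_eq_iff_cong)

lemma carrier_SL2_ZFact:
  "carrier (SL2 (ZFact (int N))) = residue_mat N ` {(a, b, c, d). [a * d - b * c = 1] (mod int N)}"
proof (intro subset_antisym subsetI)
  fix g assume "g \<in> carrier (SL2 (ZFact (int N)))"
  then obtain a b c d where "g = residue_mat N (a, b, c, d)"
      "ZMod (int N) (a * d - b * c) = ZMod (int N) 1"
    by (auto simp: SL2_def residue_mat_def ZFact_ops ZFact_minus)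
  then show "g \<in> residue_mat N ` {(a, b, c, d). [a * d - b * c = 1] (mod int N)}"
    by (auto simp: ZMod_eq_iff_cong)
next
  fix g assume "g \<in> residue_mat N ` {(a, b, c, d). [a * d - b * c = 1] (mod int N)}"
  then obtain a b c d where "g = residue_mat N (a, b, c, d)"
      "ZMod (int N) (a * d - b * c) = ZMod (int N) 1"
    by (auto simp: ZMod_eq_iff_cong)
  then show "g \<in> carrier (SL2 (ZFact (int N)))"
    by (simp add: SL2_def residue_mat_def ZFact_ops ZFact_minus)
qed

lemma group_SL2_ZFact: "group (SL2 (ZFact k))"
  by (intro cring.SL2_is_group ZFact_is_cring)

lemma finite_carrier_SL2_ZFact:
  assumes "N > 0"
  shows "finite (carrier (SL2 (ZFact (int N))))"
proof -
  have "range (ZMod (int N)) \<subseteq> ZMod (int N) ` {0..<int N}"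
  proof (rule image_subsetI)
    fix a
    have "ZMod (int N) a = ZMod (int N) (a mod int N)" by (rule ZMod_mod)
    then show "ZMod (int N) a \<in> ZMod (int N) ` {0..<int N}" using assms by simp
  qed
  then have "finite (range (ZMod (int N)))" by (rule finite_subset) simp
  moreover have "carrier (SL2 (ZFact (int N))) \<subseteq>
      range (ZMod (int N)) \<times> range (ZMod (int N)) \<times> range (ZMod (int N)) \<times> range (ZMod (int N))"
    by (auto simp: SL2_def ZFact_ops)
  ultimately show ?thesis by (meson finite_SigmaI finite_subset)
qed

text \<open>
  Left multiplication by powers of \<open>T\<close> and by \<open>S\<close> performs the Euclidean algorithm on the
  first column; the remaining diagonal matrices with \<open>a d = 1\<close> are
  \<open>T\<^sup>a S T\<^sup>d S T\<^sup>a S S\<^sup>2\<close>.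
\<close>

lemma SL2_ZFact_generated:
  fixes N :: nat
  defines "G \<equiv> SL2 (ZFact (int N))"
  assumes N: "N > 0"
    and T: "SL2_T (ZFact (int N)) \<in> X" and S: "SL2_S (ZFact (int N)) \<in> X"
    and mult: "\<And>g h. g \<in> X \<Longrightarrow> h \<in> X \<Longrightarrow> g \<otimes>\<^bsub>G\<^esub> h \<in> X"
  shows "carrier G \<subseteq> X"
proof -
  let ?m = "residue_mat N"
  have m: "?m (a * a' + b * c', a * b' + b * d', c * a' + d * c', c * b' + d * d') \<in> X"
    if "?m (a, b, c, d) \<in> X" "?m (a', b', c', d') \<in> X" for a b c d a' b' c' d'
    using mult [OF that] by (simp add: G_def SL2_ZFact_mult)
  have S1: "?m (0, -1, 1, 0) \<in> X" using S by (simp add: SL2_S_ZFact)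
  have S2: "?m (-1, 0, 0, -1) \<in> X" using m [OF S1 S1] by simp
  have S3: "?m (0, 1, -1, 0) \<in> X" using m [OF S1 S2] by simp
  have S4: "?m (1, 0, 0, 1) \<in> X" using m [OF S2 S2] by simp
  have "?m (1, int n, 0, 1) \<in> X" for n
  proof (induction n)
    case (Suc n)
    show ?case using m [OF Suc T [unfolded SL2_T_ZFact]] by (simp add: add.commute)
  qed (use S4 in simp)
  \<comment> \<open>\<open>X\<close> is closed under products only, so a negative power of T is
    obtained as the nonnegative power with the exponent reduced modulo N.\<close>
  then have "?m (1, int (nat (x mod int N)), 0, 1) \<in> X" for x .
  moreover have "?m (1, int (nat (x mod int N)), 0, 1) = ?m (1, x, 0, 1)" for x
    using N by (simp add: residue_mat_eq_iff cong_def)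
  ultimately have Tx: "?m (1, x, 0, 1) \<in> X" for x by simp
  have TS: "?m (x, -1, 1, 0) \<in> X" for x using m [OF Tx [of x] S1] by simp
  have diag: "?m (a, 0, 0, d) \<in> X" if "[a * d = 1] (mod int N)" for a d
  proof -
    have "?m ((a * d - 1) * a - a, 1 - a * d, d * a - 1, - d) \<in> X"
      using m [OF m [OF TS [of a] TS [of d]] TS [of a]] by simp
    moreover have "?m ((a * d - 1) * a - a, 1 - a * d, d * a - 1, - d) = ?m (- a, 0, 0, - d)"
      using that by (simp add: residue_mat_eq_iff cong_iff_dvd_diff mult.commute dvd_diff_commute)
    ultimately have "?m (- a, 0, 0, - d) \<in> X" by simp
    from m [OF this S2] show ?thesis by simp
  qed
  have gen: "?m (a, b, c, d) \<in> X" if "[a * d - b * c = 1] (mod int N)" for a b c d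
    using that
  proof (induction "nat \<bar>c\<bar>" arbitrary: a b c d rule: less_induct)
    case less
    show ?case
    proof (cases "c = 0")
      case True
      then have ad: "[a * d = 1] (mod int N)" using less.prems by simp
      have "?m (a, a * (d * b), 0, d) \<in> X"
        using m [OF diag [OF ad] Tx [of "d * b"]] by simp
      moreover have "[a * (d * b) = b] (mod int N)"
        using cong_scalar_right [OF ad, of b] by (simp add: mult.assoc)
      then have "?m (a, a * (d * b), 0, d) = ?m (a, b, 0, d)"
        by (simp add: residue_mat_eq_iff)
      ultimately show ?thesis using True by simp
    next
      case False
      define q where "q = a div c"
      define a' where "a' = a mod c"
      have a: "a = a' + q * c" by (simp add: q_def a'_def)
      have "\<bar>a'\<bar> < \<bar>c\<bar>" using False unfolding a'_def by (rule abs_mod_less)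
      \<comment> \<open>This matrix is S T^(-q) g for the given g = (a, b, c, d): its lower left
        entry is the remainder of a by c, so the induction hypothesis applies. Multiplying by
        \<open>S3\<close>, the inverse of S, and then by T^q recovers g.\<close>
      then have "?m (- c, - d, a', b - q * d) \<in> X"
        using less.prems by (intro less.hyps) (simp_all add: a algebra_simps)
      from m [OF S3 this] have "?m (a', b - q * d, c, d) \<in> X" by simp
      from m [OF Tx [of q] this] show ?thesis by (simp add: a)
    qed
  qed
  show ?thesis using gen by (auto simp: G_def carrier_SL2_ZFact)
qed

text \<open>The columns of a matrix power are the iterated images of the two basis vectors. This
  turns g^l = 1 in the quotient group into congruences between integer vectors.\<close>

lemma SL2_ZFact_pow:
  "residue_mat N (a, b, c, d) [^]\<^bsub>SL2 (ZFact (int N))\<^esub> n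
    = residue_mat N (fst ((matvec (a, b, c, d) ^^ n) (1, 0)), fst ((matvec (a, b, c, d) ^^ n) (0, 1)),
        snd ((matvec (a, b, c, d) ^^ n) (1, 0)), snd ((matvec (a, b, c, d) ^^ n) (0, 1)))"
  if "[a * d - b * c = 1] (mod int N)" for n :: nat
proof -
  interpret group "SL2 (ZFact (int N))" by (rule group_SL2_ZFact)
  have g: "residue_mat N (a, b, c, d) \<in> carrier (SL2 (ZFact (int N)))"
    using that by (auto simp: carrier_SL2_ZFact)
  show ?thesis
  proof (induction n)
    case 0
    show ?case by (simp add: SL2_ZFact_one)
  next
    case (Suc n)
    show ?case
      by (simp only: nat_pow_Suc2 [OF g] Suc SL2_ZFact_mult funpow.simps comp_apply)
        (simp add: matvec_def split: prod.splits)
  qed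
qed

lemma not_prime_dvd_order_SL2_ZFact:
  fixes N l :: nat
  assumes N: "N > 0" and l: "prime l" and less: "\<And>p. prime p \<Longrightarrow> p dvd N \<Longrightarrow> p + 1 < l"
  shows "\<not> l dvd order (SL2 (ZFact (int N)))"
proof (rule not_prime_dvd_order)
  fix g assume "g \<in> carrier (SL2 (ZFact (int N)))"
    and g_pow: "g [^]\<^bsub>SL2 (ZFact (int N))\<^esub> l = \<one>\<^bsub>SL2 (ZFact (int N))\<^esub>"
  then obtain a b c d where g: "g = residue_mat N (a, b, c, d)" and det: "[a * d - b * c = 1] (mod int N)"
    by (auto simp: carrier_SL2_ZFact)
  let ?A = "(a, b, c, d)"
  have basis: "cong_vec N ((matvec ?A ^^ l) (1, 0)) (1, 0)" "cong_vec N ((matvec ?A ^^ l) (0, 1)) (0, 1)"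
    using g_pow unfolding g SL2_ZFact_pow [OF det] SL2_ZFact_one
    by (simp_all add: residue_mat_eq_iff cong_vec_def)
  have "cong_vec N ((matvec ?A ^^ l) v) v" for v
  proof -
    have v: "v = scale_vec (fst v) (1, 0) + scale_vec (snd v) (0, 1)"
      by (cases v) (simp add: scale_vec_def)
    have "cong_vec N (scale_vec (fst v) ((matvec ?A ^^ l) (1, 0)) + scale_vec (snd v) ((matvec ?A ^^ l) (0, 1)))
        (scale_vec (fst v) (1, 0) + scale_vec (snd v) (0, 1))"
      by (intro cong_vec_add cong_vec_scale basis)
    then show ?thesis
      by (subst (1 2) v) (simp only: iter_matvec_add iter_matvec_scale)
  qed
  then have "cong_vec N (matvec ?A v) v" for v
    by (intro fixed_mod_if_iter_fixed [where l = l] N l less)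
  from this [of "(1, 0)"] this [of "(0, 1)"]
  show "g = \<one>\<^bsub>SL2 (ZFact (int N))\<^esub>"
    by (simp add: g SL2_ZFact_one residue_mat_eq_iff cong_vec_def matvec_def)
qed (use N l group_SL2_ZFact finite_carrier_SL2_ZFact in auto)

text \<open>From p <= N <= l - 1, failure forces p = N = l - 1. Two consecutive primes are 2 and 3,
  which is exactly the excluded pair.\<close>

lemma prime_factor_less:
  fixes N l :: nat
  assumes l: "prime l" and cong: "[l = 1] (mod N)" and "(N, l) \<noteq> (2, 3)"
    and p: "prime p" "p dvd N"
  shows "p + 1 < l"
proof -
  have "N dvd l - 1" using cong prime_gt_1_nat [OF l]
    by (simp add: cong_altdef_nat)
  then have le: "N \<le> l - 1" using prime_gt_1_nat [OF l] by (intro dvd_imp_le) auto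
  have "p \<noteq> 0" "p > 1" using p prime_gt_1_nat by auto
  have pN: "p \<le> N" using p le prime_gt_1_nat [OF l] \<open>N dvd l - 1\<close>
    by (intro dvd_imp_le) (auto intro!: Nat.gr0I)
  show ?thesis
  proof (rule ccontr)
    assume "\<not> p + 1 < l"
    then have eq: "l = p + 1" "N = p" using le pN prime_gt_1_nat [OF l] by auto
    have "p = 2"
    proof (rule ccontr)
      assume "p \<noteq> 2"
      then have "odd p" using p(1) \<open>p > 1\<close> prime_odd_nat [of p] by linarith
      then have "even l" using eq by simp
      then have "l = 2" using l two_is_prime_nat primes_dvd_imp_eq by blast
      then show False using eq \<open>p > 1\<close> by simp
    qed
    then show False using eq assms(3) by simp
  qed
qed

section \<open>Divisibility in the \<open>\<ell>\<close>-adic integers\<close>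

lemma padic_residue_of_nat: "padic_residue (of_nat k :: 'p::prime_card padic_int) = of_nat k"
proof (induction k)
  case 0
  show ?case by (simp add: padic_residue_eq_0_iff)
next
  case (Suc k)
  then show ?case by (simp add: padic_residue_add padic_residue_one)
qed

lemma padic_residue_zero [simp]: "padic_residue 0 = 0"
  by (simp add: padic_residue_eq_0_iff)

text \<open>A nonzero residue makes every component invertible modulo its power of the prime. The
  inverses, reduced to standard representatives, form a compatible sequence because inverses are
  unique modulo each power.\<close>

lemma padic_int_unit:
  fixes a :: "'p::prime_card padic_int"
  assumes "padic_residue a \<noteq> 0"
  shows "a dvd 1"
proof -
  let ?p = "int CARD('p)"
  have p: "prime ?p" by (rule prime_card_int)
  have "\<not> ?p dvd Rep_padic_int a 1"
  proof
    assume "?p dvd Rep_padic_int a 1"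
    then have "Rep_padic_int a 1 mod ?p = 0" by simp
    then have "padic_residue a = 0" unfolding padic_residue_def by transfer simp
    then show False using assms by simp
  qed
  then have "\<not> ?p dvd Rep_padic_int a (Suc n)" for n
    using Rep_padic_int_mod [of a 1 n] by (simp add: dvd_mod_iff)
  then have "coprime (Rep_padic_int a n) (?p ^ n)" for n
    using p by (cases n) (auto simp: coprime_commute prime_imp_coprime)
  then have "\<exists>b. [Rep_padic_int a n * b = 1] (mod ?p ^ n)" for n
    by (simp add: coprime_iff_invertible_int)
  then obtain g where g: "\<And>n. [Rep_padic_int a n * g n = 1] (mod ?p ^ n)" by metis
  define f where "f n = g n mod ?p ^ n" for n
  have f: "[Rep_padic_int a n * f n = 1] (mod ?p ^ n)" for n
    using g [of n] by (simp add: f_def cong_def mod_mult_right_eq)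
  have "f (Suc n) mod ?p ^ n = f n" for n
  proof -
    have "[Rep_padic_int a (Suc n) * f (Suc n) = 1] (mod ?p ^ n)"
      using f [of "Suc n"] by (rule cong_dvd_modulus) simp
    moreover have "[Rep_padic_int a n = Rep_padic_int a (Suc n)] (mod ?p ^ n)"
      using Rep_padic_int_mod [of a n 1] by (simp add: cong_def)
    ultimately have 1: "[Rep_padic_int a n * f (Suc n) = 1] (mod ?p ^ n)"
      using cong_mult [OF _ cong_refl] cong_trans by blast
    \<comment> \<open>Uniqueness of the inverse: both \<open>f n\<close> and
      \<open>f (Suc n)\<close> invert the n-th component of \<open>a\<close>.\<close>
    have "[f (Suc n) = f (Suc n) * (Rep_padic_int a n * f n)] (mod ?p ^ n)"
      using cong_mult [OF cong_refl f [of n], of "f (Suc n)"] by (simp add: cong_sym)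
    also have "f (Suc n) * (Rep_padic_int a n * f n) = Rep_padic_int a n * f (Suc n) * f n"
      by (simp add: mult_ac)
    also have "[\<dots> = 1 * f n] (mod ?p ^ n)" by (intro cong_mult 1 cong_refl)
    finally show ?thesis by (simp add: cong_def f_def)
  qed
  then have Rep: "Rep_padic_int (Abs_padic_int f :: 'p padic_int) = f"
    by (intro Abs_padic_int_inverse) simp
  have "a * Abs_padic_int f = 1"
    by (subst Rep_padic_int_inject [symmetric], rule ext)
      (use f in \<open>simp add: times_padic_int.rep_eq one_padic_int.rep_eq Rep cong_def\<close>)
  then show ?thesis by (metis dvd_triv_left)
qed

text \<open>The exponent is the valuation of \<open>a\<close>. A nonzero component at level n rules
  out divisibility by the n-th power of the prime, so a largest exponent exists; by maximality the
  cofactor has nonzero residue and is a unit.\<close>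

lemma padic_int_decompose:
  fixes a :: "'p::prime_card padic_int"
  assumes "a \<noteq> 0"
  shows "\<exists>n u. a = of_nat CARD('p) ^ n * u \<and> u dvd 1"
proof -
  let ?l = "of_nat CARD('p) :: 'p padic_int"
  obtain n where n: "Rep_padic_int a n \<noteq> 0"
    using assms by (metis Rep_padic_int_inject ext zero_padic_int.rep_eq)
  have bound: "k < n" if dvd: "?l ^ k dvd a" for k
  proof (rule ccontr)
    assume "\<not> k < n"
    then have "?l ^ n dvd a" using dvd by (meson dvd_trans le_imp_power_dvd not_less)
    then obtain b where "a = of_nat (CARD('p) ^ n) * b" by (auto elim: dvdE)
    then have "Rep_padic_int a n = 0"
      by (simp only: times_padic_int.rep_eq Rep_of_nat_padic_int) simp
    then show False using n by simp
  qed
  define m where "m = Max {k. ?l ^ k dvd a}"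
  have fin: "finite {k. ?l ^ k dvd a}" 
    by (rule finite_subset [of _ "{..<n}"]) (use bound in auto)
  have "?l ^ 0 dvd a" by simp
  then have "m \<in> {k. ?l ^ k dvd a}" unfolding m_def by (intro Max_in fin) blast
  then obtain u where u: "a = ?l ^ m * u" by auto
  have "padic_residue u \<noteq> 0"
  proof
    assume "padic_residue u = 0"
    then obtain v where "u = ?l * v" by (auto simp: padic_residue_eq_0_iff)
    then have "?l ^ Suc m dvd a" by (simp add: u mult_ac)
    then have "Suc m \<le> m" unfolding m_def by (intro Max_ge fin) simp
    then show False by simp
  qed
  then show ?thesis using u padic_int_unit by blast
qed

lemma padic_int_dvd_total:
  fixes a b :: "'p::prime_card padic_int"
  shows "a dvd b \<or> b dvd a"
proof (cases "a = 0 \<or> b = 0")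
  case False
  then obtain m n u v where a: "a = of_nat CARD('p) ^ m * u" "u dvd 1"
    and b: "b = of_nat CARD('p) ^ n * v" "v dvd 1"
    using padic_int_decompose by metis
  have "u dvd v" "v dvd u" using a b by (meson dvd_trans one_dvd)+
  then show ?thesis using a b le_imp_power_dvd mult_dvd_mono nat_le_linear by metis
qed auto

lemma padic_of_int_hom [simp]:
  "padic_of_int 0 = 0" "padic_of_int 1 = 1"
  "padic_of_int (a + b) = padic_of_int a + padic_of_int b"
  "padic_of_int (a * b) = padic_of_int a * padic_of_int b"
  by (simp_all add: padic_of_int_def Zero_fract_def One_fract_def)

lemma padic_of_int_eq_iff [simp]: "padic_of_int a = padic_of_int b \<longleftrightarrow> a = b"
  by (simp add: padic_of_int_def eq_fract)

lemma padic_of_int_power [simp]: "padic_of_int (a ^ n) = padic_of_int a ^ n"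
  by (induction n) simp_all

lemma padic_of_int_of_nat [simp]: "padic_of_int (of_nat n) = of_nat n"
  by (induction n) simp_all

lemma padic_of_int_sum: "padic_of_int (sum f S) = (\<Sum>x\<in>S. padic_of_int (f x))"
  by (induction S rule: infinite_finite_induct) simp_all

lemma padic_integral_or_inverse:
  fixes x :: "'p::prime_card padic"
  shows "(\<exists>a. x = padic_of_int a) \<or> (\<exists>a. inverse x = padic_of_int a)"
proof -
  obtain a b where x: "x = Fract a b" "b \<noteq> 0" by (cases x)
  from padic_int_dvd_total [of b a] show ?thesis
  proof
    assume "b dvd a"
    then obtain c where "a = b * c" by blast
    then have "x = padic_of_int c" using x by (simp add: padic_of_int_def eq_fract)
    then show ?thesis by blast
  next
    assume "a dvd b"
    then obtain c where c: "b = a * c" by blast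
    then have "inverse x = padic_of_int c" using x by (simp add: padic_of_int_def eq_fract)
    then show ?thesis by blast
  qed
qed

text \<open>If only the inverse of x is known to be integral, then x is too, being the (n - 1)-st
  power of that inverse.\<close>

lemma padic_root_of_unity_integral:
  fixes x :: "'p::prime_card padic"
  assumes "x ^ n = 1" "n > 0"
  shows "\<exists>a. x = padic_of_int a"
proof (cases "\<exists>a. x = padic_of_int a")
  case False
  then obtain a where a: "inverse x = padic_of_int a"
    using padic_integral_or_inverse by blast
  have "x \<noteq> 0" using assms by (metis power_0_left not_gr_zero zero_neq_one)
  have "inverse x ^ n = 1" using assms by (simp add: power_inverse)
  then have "inverse x ^ (n - 1) = x"
    using \<open>n > 0\<close> \<open>x \<noteq> 0\<close> by (metis inverse_inverse_eq inverse_unique power_minus_mult)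
  then show ?thesis using a by (metis padic_of_int_power)
qed

lemma padic_inverse_of_nat_integral:
  assumes "\<not> CARD('p) dvd n"
  shows "\<exists>a :: 'p::prime_card padic_int. a * of_nat n = 1"
proof -
  have "padic_residue (of_nat n :: 'p padic_int) \<noteq> 0"
    using assms of_nat_0_mod_ring_dvd by (auto simp: padic_residue_of_nat)
  then show ?thesis using padic_int_unit by (metis dvdE mult.commute)
qed

section \<open>The order of a finite quadratic module\<close>

lemma sum_const_add:
  fixes m n :: nat
  shows "(\<Sum>i<m + n. x) = (\<Sum>i<m. x) + (\<Sum>i<n. x :: 'a::ab_group_add)"
  by (induction n) (simp_all add: algebra_simps)

lemma sum_const_mult:
  fixes m n :: nat
  shows "(\<Sum>i<m * n. x) = (\<Sum>i<n. \<Sum>i<m. x :: 'a::ab_group_add)"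
  by (induction n) (simp_all add: sum_const_add algebra_simps)

lemma int_mult_int: "int_mult (int n) x = (\<Sum>i<n. x)"
  by (simp add: int_mult_def)

text \<open>Translation by x permutes the group, so the sum of all elements is unchanged when x is
  added to each of them.\<close>

lemma sum_const_card_eq_0: "(\<Sum>i<CARD('a). x) = (0 :: 'a::{finite,ab_group_add})"
proof -
  have const: "(\<Sum>i<card A. x) = (\<Sum>y\<in>A. x)" if "finite A" for A :: "'a set"
    using that by (induction A) (simp_all add: add.commute)
  have "(\<Sum>y\<in>UNIV. y) = (\<Sum>y\<in>UNIV. y + x)"
    by (rule sum.reindex_bij_witness [where i = "\<lambda>y. y + x" and j = "\<lambda>y. y - x"]) auto
  also have "\<dots> = (\<Sum>y\<in>UNIV. y) + (\<Sum>i<CARD('a). x)" by (simp add: sum.distrib const)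
  finally show ?thesis by simp
qed

text \<open>The \<open>LEAST\<close> in \<open>level\<close> needs a witness. The square of |A| is
  one: it sends Q(x) to Q(|A| x) = Q(0) = 0.\<close>

lemma level_annihilates:
  assumes "quadratic_form Q"
  shows "(\<Sum>i<level Q. Q x) = 0"
proof -
  let ?P = "\<lambda>n. 1 \<le> n \<and> (\<forall>x. int_mult (int n) (Q x) = 0)"
  have quad: "Q (int_mult k x) = int_mult (k ^ 2) (Q x)" for k x
    using assms by (simp add: quadratic_form_def)
  have Q0: "Q 0 = 0" using quad [of 0 0] by (simp add: int_mult_def)
  have "?P (CARD('a) ^ 2)"
  proof (intro conjI allI)
    fix x
    have "int_mult (int (CARD('a) ^ 2)) (Q x) = Q (int_mult (int CARD('a)) x)"
      by (simp add: quad)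
    then show "int_mult (int (CARD('a) ^ 2)) (Q x) = 0"
      by (simp only: int_mult_int sum_const_card_eq_0 Q0)
  qed simp
  then have "?P (level Q)" unfolding level_def by (rule LeastI)
  then show ?thesis by (simp add: int_mult_int)
qed

text \<open>The level kills the values of Q, hence those of the bilinear form; by bilinearity N x is
  orthogonal to everything, and nondegeneracy applies.\<close>

lemma level_annihilates_group:
  fixes Q :: "'a::{finite,ab_group_add} \<Rightarrow> rat_mod_int" and x :: 'a
  assumes "finite_quadratic_module Q"
  shows "(\<Sum>i<level Q. x) = 0"
proof -
  have Q: "quadratic_form Q" and nondeg: "\<And>x. (\<And>y. polar Q x y = 0) \<Longrightarrow> x = 0"
    using assms by (auto simp: finite_quadratic_module_def)
  have add: "polar Q (x + x') y = polar Q x y + polar Q x' y" for x x' y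
    using Q by (simp add: quadratic_form_def)
  have zero: "polar Q 0 y = 0" for y using add [of 0 0 y] by simp
  have "polar Q (\<Sum>i<n. x) y = (\<Sum>i<n. polar Q x y)" for n :: nat and y
    by (induction n) (simp_all add: add zero)
  moreover have "(\<Sum>i<level Q. polar Q x y) = 0" for y
    by (simp only: polar_def sum_subtractf level_annihilates [OF Q]) simp
  ultimately show ?thesis by (intro nondeg) simp
qed

text \<open>Makes the factor 1/|A| in the action of S an l-adic integer. Since l = 1 + N q and N
  kills the group, l x = x, so there is no element of order l.\<close>

lemma not_prime_dvd_card_module:
  fixes Q :: "'a::{finite,ab_group_add} \<Rightarrow> rat_mod_int"
  assumes "finite_quadratic_module Q" and l: "prime l" "[l = 1] (mod level Q)"
  shows "\<not> l dvd CARD('a)"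
proof -
  let ?G = "\<lparr>carrier = UNIV, monoid.mult = (+), one = 0\<rparr> :: 'a monoid"
  have group: "group ?G"
    by (rule groupI) (auto simp: add.assoc intro: exI [of _ "- x" for x])
  have pow: "x [^]\<^bsub>?G\<^esub> n = (\<Sum>i<n. x)" for x and n :: nat
    by (induction n) (simp_all add: nat_pow_def)
  obtain q where q: "l = 1 + level Q * q"
    using l prime_gt_1_nat [of l] by (metis cong_altdef_nat dvdE le_add_diff_inverse less_imp_le)
  have "\<not> l dvd order ?G"
  proof (rule not_prime_dvd_order [OF group _ l(1)])
    fix g assume "g [^]\<^bsub>?G\<^esub> l = \<one>\<^bsub>?G\<^esub>"
    then have "(\<Sum>i<l. g) = 0" by (simp add: pow)
    moreover have "(\<Sum>i<l. g) = g"
      unfolding q sum_const_add sum_const_mult level_annihilates_group [OF assms(1)] by simp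
    ultimately show "g = \<one>\<^bsub>?G\<^esub>" by simp
  qed simp
  then show ?thesis by (simp add: order_def)
qed

section \<open>Reduction of lattice-preserving maps\<close>

lemma lattice_embedding_eq_iff [simp]: "lattice_embedding u = lattice_embedding v \<longleftrightarrow> u = v"
  by (auto simp: lattice_embedding_def vec_eq_iff)

lemma lattice_embedding_add: "lattice_embedding (u + v) = lattice_embedding u + lattice_embedding v"
  by (simp add: lattice_embedding_def vec_eq_iff)

lemma lattice_embedding_diff: "lattice_embedding (u - v) = lattice_embedding u - lattice_embedding v"
  using lattice_embedding_add [of "u - v" v] by simp

lemma lattice_embedding_zero [simp]: "lattice_embedding 0 = 0"
  by (simp add: lattice_embedding_def vec_eq_iff)

lemma lattice_embedding_scale: "lattice_embedding (c *s u) = padic_of_int c *s lattice_embedding u"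
  by (simp add: lattice_embedding_def vec_eq_iff)

lemma lattice_embedding_axis: "lattice_embedding (axis x 1) = axis x 1"
  by (simp add: lattice_embedding_def vec_eq_iff axis_def)

lemma lattice_embedding_sum: "lattice_embedding (sum f S) = (\<Sum>x\<in>S. lattice_embedding (f x))"
  by (induction S rule: infinite_finite_induct) (simp_all add: lattice_embedding_add)

lemma lattice_reduction_add: "lattice_reduction (u + v) = lattice_reduction u + lattice_reduction v"
  by (simp add: lattice_reduction_def vec_eq_iff padic_residue_add)

lemma lattice_reduction_diff: "lattice_reduction (u - v) = lattice_reduction u - lattice_reduction v"
  using lattice_reduction_add [of "u - v" v] by simp

lemma lattice_reduction_zero [simp]: "lattice_reduction 0 = 0"
  by (simp add: lattice_reduction_def vec_eq_iff)

lemma lattice_reduction_scale: "lattice_reduction (c *s u) = padic_residue c *s lattice_reduction u"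
  by (simp add: lattice_reduction_def vec_eq_iff padic_residue_mult)

lemma lattice_reduction_sum: "lattice_reduction (sum f S) = (\<Sum>x\<in>S. lattice_reduction (f x))"
  by (induction S rule: infinite_finite_induct) (simp_all add: lattice_reduction_add)

lemma lattice_reduction_eq_iff:
  fixes u v :: "'p::prime_card padic_int ^ 'a::finite"
  shows "lattice_reduction u = lattice_reduction v \<longleftrightarrow> (\<exists>w. u = v + of_nat CARD('p) *s w)"
proof
  assume "lattice_reduction u = lattice_reduction v"
  then have "lattice_reduction (u - v) = 0" by (simp add: lattice_reduction_diff)
  then have "\<forall>x. \<exists>c. u $ x - v $ x = of_nat CARD('p) * c"
    by (simp add: lattice_reduction_def vec_eq_iff padic_residue_eq_0_iff dvd_def)
  then obtain c where "u $ x - v $ x = of_nat CARD('p) * c x" for x by metis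
  then have "u = v + of_nat CARD('p) *s (\<chi> x. c x)"
    by (simp add: vec_eq_iff algebra_simps)
  then show "\<exists>w. u = v + of_nat CARD('p) *s w" ..
next
  assume "\<exists>w. u = v + of_nat CARD('p) *s w"
  moreover have "padic_residue (of_nat CARD('p) :: 'p padic_int) = 0"
    by (simp add: padic_residue_eq_0_iff)
  ultimately show "lattice_reduction u = lattice_reduction v"
    by (auto simp: lattice_reduction_add lattice_reduction_scale)
qed

lemma surj_lattice_reduction: "\<exists>u. lattice_reduction u = (v :: 'p::prime_card mod_ring ^ 'a::finite)"
proof -
  have "\<forall>x. \<exists>c :: 'p padic_int. v $ x = padic_residue c"
    by (intro allI surjD surj_padic_residue)
  then obtain c :: "'a \<Rightarrow> 'p padic_int" where "v $ x = padic_residue (c x)" for x by metis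
  then have "lattice_reduction (\<chi> x. c x) = v" by (simp add: lattice_reduction_def vec_eq_iff)
  then show ?thesis ..
qed

definition preserves_lattice :: "('p::prime_card padic ^ 'a::finite \<Rightarrow> 'p padic ^ 'a) \<Rightarrow> bool" where
  "preserves_lattice f \<longleftrightarrow> (\<forall>u. \<exists>u'. f (lattice_embedding u) = lattice_embedding u')"

lemma in_lattice_scale:
  "v \<in> range lattice_embedding \<Longrightarrow> padic_of_int c *s v \<in> range lattice_embedding"
  by (auto simp flip: lattice_embedding_scale)

lemma in_lattice_sum:
  assumes "\<And>x. x \<in> S \<Longrightarrow> f x \<in> range lattice_embedding"
  shows "sum f S \<in> range lattice_embedding"
proof -
  obtain g where "\<And>x. x \<in> S \<Longrightarrow> f x = lattice_embedding (g x)"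
    using assms unfolding image_iff by metis
  then have "sum f S = lattice_embedding (sum g S)" by (simp add: lattice_embedding_sum)
  then show ?thesis by blast
qed

lemma preserves_lattice_if_axis:
  fixes f :: "'p::prime_card padic ^ 'a::finite \<Rightarrow> 'p padic ^ 'a"
  assumes "Vector_Spaces.linear (*s) (*s) f" "\<And>x. f (axis x 1) \<in> range lattice_embedding"
  shows "preserves_lattice f"
  unfolding preserves_lattice_def
proof
  fix u :: "'p padic_int ^ 'a"
  interpret f: Vector_Spaces.linear "(*s)" "(*s)" f by fact
  have "lattice_embedding u = (\<Sum>x\<in>UNIV. padic_of_int (u $ x) *s axis x 1)"
    by (subst basis_expansion [symmetric]) (simp add: lattice_embedding_def)
  then have "f (lattice_embedding u) = (\<Sum>x\<in>UNIV. padic_of_int (u $ x) *s f (axis x 1))"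
    by (simp add: f.sum f.scale)
  also have "\<dots> \<in> range lattice_embedding"
    by (intro in_lattice_sum in_lattice_scale assms)
  finally show "\<exists>u'. f (lattice_embedding u) = lattice_embedding u'" by blast
qed

text \<open>The description in \<open>induced_map\<close> has a unique solution: two lifts of a
  vector differ by a multiple of the prime, and a linear lattice-preserving map sends this
  difference to such a multiple again.\<close>

lemma induced_map_eq:
  fixes f :: "'p::prime_card padic ^ 'a::finite \<Rightarrow> 'p padic ^ 'a"
  assumes lin: "Vector_Spaces.linear (*s) (*s) f" and pres: "preserves_lattice f"
    and u: "f (lattice_embedding u) = lattice_embedding u'"
  shows "induced_map f (lattice_reduction u) = lattice_reduction u'"
  unfolding induced_map_def
proof (rule the_equality)
  interpret f: Vector_Spaces.linear "(*s)" "(*s)" f by (fact lin)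
  fix v' assume "\<exists>u1 u1'. lattice_reduction u1 = lattice_reduction u \<and>
    lattice_embedding u1' = f (lattice_embedding u1) \<and> v' = lattice_reduction u1'"
  then obtain u1 u1' w where 1: "u1 = u + of_nat CARD('p) *s w"
    "lattice_embedding u1' = f (lattice_embedding u1)" "v' = lattice_reduction u1'"
    by (auto simp: lattice_reduction_eq_iff)
  obtain w' where w': "f (lattice_embedding w) = lattice_embedding w'"
    using pres by (auto simp: preserves_lattice_def)
  have "lattice_embedding u1' = lattice_embedding (u' + of_nat CARD('p) *s w')"
    by (simp add: 1 lattice_embedding_add lattice_embedding_scale f.add f.scale u w')
  then show "v' = lattice_reduction u'"
    by (auto simp: 1(3) lattice_reduction_eq_iff)
qed (use u [symmetric] in blast)

lemma linear_iff_vec: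
  "Vector_Spaces.linear (*s) (*s) f \<longleftrightarrow>
    (\<forall>x y. f (x + y) = f x + f y) \<and> (\<forall>c x. f (c *s x) = c *s f x)"
  for f :: "'k::field ^ 'm \<Rightarrow> 'k ^ 'n"
  by (simp add: Vector_Spaces.linear_iff vec.vector_space_axioms)

lemma linear_induced_map:
  fixes f :: "'p::prime_card padic ^ 'a::finite \<Rightarrow> 'p padic ^ 'a"
  assumes lin: "Vector_Spaces.linear (*s) (*s) f" and pres: "preserves_lattice f"
  shows "Vector_Spaces.linear (*s) (*s) (induced_map f)"
  unfolding linear_iff_vec
proof (intro conjI allI)
  interpret f: Vector_Spaces.linear "(*s)" "(*s)" f by (fact lin)
  note eq = induced_map_eq [OF lin pres]
  obtain r where r: "\<And>u. f (lattice_embedding u) = lattice_embedding (r u)"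
    using pres unfolding preserves_lattice_def by metis
  fix x y :: "'p mod_ring ^ 'a" and c
  obtain u v and d :: "'p padic_int" where [symmetric]: "lattice_reduction u = x" "lattice_reduction v = y" "padic_residue d = c"
    using surj_lattice_reduction surj_padic_residue by (metis surjD)
  note xy = this
  have "f (lattice_embedding (u + v)) = lattice_embedding (r u + r v)"
    by (simp add: lattice_embedding_add f.add r)
  from eq [OF this] show "induced_map f (x + y) = induced_map f x + induced_map f y"
    by (simp add: xy lattice_reduction_add eq [OF r])
  have "f (lattice_embedding (d *s u)) = lattice_embedding (d *s r u)"
    by (simp add: lattice_embedding_scale f.scale r)
  from eq [OF this] show "induced_map f (c *s x) = c *s induced_map f x"
    by (simp add: xy lattice_reduction_scale eq [OF r])
qed

text \<open>Selects a coefficient of least valuation. Dividing a linear relation by it makes all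
  coefficients integral and one of them 1.\<close>

lemma padic_max_coefficient:
  fixes c :: "'b \<Rightarrow> 'p::prime_card padic"
  assumes "finite S" "\<exists>x\<in>S. c x \<noteq> 0"
  shows "\<exists>y\<in>S. c y \<noteq> 0 \<and> (\<forall>x\<in>S. \<exists>a. c x = padic_of_int a * c y)"
  using assms
proof (induction S)
  case (insert z S)
  show ?case
  proof (cases "\<exists>x\<in>S. c x \<noteq> 0")
    case False
    then have "c z \<noteq> 0" using insert by auto
    moreover have "\<forall>x\<in>insert z S. \<exists>a. c x = padic_of_int a * c z"
      using False by (metis insert_iff mult_1 mult_zero_left padic_of_int_hom(1,2))
    ultimately show ?thesis by blast
  next
    case True
    then obtain y where y: "y \<in> S" "c y \<noteq> 0" "\<forall>x\<in>S. \<exists>a. c x = padic_of_int a * c y"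
      using insert by blast
    show ?thesis
    proof (cases "\<exists>a. c z / c y = padic_of_int a")
      case True
      then have "\<exists>a. c z = padic_of_int a * c y" using y by (metis nonzero_divide_eq_eq)
      then show ?thesis using y by blast
    next
      case False
      then obtain a where a: "inverse (c z / c y) = padic_of_int a"
        using padic_integral_or_inverse by blast
      have z: "c z \<noteq> 0" using False by (metis div_0 padic_of_int_hom(1))
      then have "c y = padic_of_int a * c z" using a by (simp add: field_simps)
      then have "\<forall>x\<in>S. \<exists>b. c x = padic_of_int b * c z"
        using y(3) by (metis mult.assoc padic_of_int_hom(4))
      moreover have "c z = padic_of_int 1 * c z" by simp
      ultimately show ?thesis using z by blast
    qed
  qed
qed simp

text \<open>A relation among the lifts can be rescaled to have integral coefficients, one equal to
  1. Its reduction is then a nontrivial relation in \<open>B\<close>.\<close>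

lemma independent_lift:
  fixes w :: "'p::prime_card mod_ring ^ 'a::finite \<Rightarrow> 'p padic_int ^ 'a"
  assumes B: "vec.independent B" "finite B" and w: "\<And>b. b \<in> B \<Longrightarrow> lattice_reduction (w b) = b"
  shows "inj_on (\<lambda>b. lattice_embedding (w b)) B"
    and "vec.independent ((\<lambda>b. lattice_embedding (w b)) ` B)"
proof -
  let ?h = "\<lambda>b. lattice_embedding (w b)"
  show inj: "inj_on ?h B" by (rule inj_onI) (metis lattice_embedding_eq_iff w)
  show "vec.independent (?h ` B)"
  proof
    assume "vec.dependent (?h ` B)"
    then obtain c where c: "\<exists>v\<in>?h ` B. c v \<noteq> 0" "(\<Sum>v\<in>?h ` B. c v *s v) = 0"
      using B(2) by (subst (asm) vec.dependent_finite) auto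
    obtain b0 where b0: "b0 \<in> B" "c (?h b0) \<noteq> 0" "\<forall>b\<in>B. \<exists>a. c (?h b) = padic_of_int a * c (?h b0)"
      using padic_max_coefficient [OF B(2), of "\<lambda>b. c (?h b)"] c(1) by auto
    then obtain a where a: "\<And>b. b \<in> B \<Longrightarrow> c (?h b) = padic_of_int (a b) * c (?h b0)" by metis
    have "padic_of_int (a b0) * c (?h b0) = padic_of_int 1 * c (?h b0)" using a [OF b0(1)] by simp
    then have ab0: "a b0 = 1" using b0(2) by (simp only: mult_cancel_right padic_of_int_eq_iff simp_thms)
    have "0 = (\<Sum>b\<in>B. c (?h b) *s ?h b)" using c(2) by (simp add: sum.reindex [OF inj])
    also have "\<dots> = (\<Sum>b\<in>B. c (?h b0) *s (padic_of_int (a b) *s ?h b))"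
      by (intro sum.cong refl) (simp add: a mult.commute)
    also have "\<dots> = c (?h b0) *s lattice_embedding (\<Sum>b\<in>B. a b *s w b)"
      by (simp add: lattice_embedding_sum lattice_embedding_scale vec.scale_sum_right)
    finally have "lattice_embedding (\<Sum>b\<in>B. a b *s w b) = lattice_embedding 0"
      using b0(2) by simp
    then have "(\<Sum>b\<in>B. a b *s w b) = 0" by (simp only: lattice_embedding_eq_iff)
    then have "lattice_reduction (\<Sum>b\<in>B. a b *s w b) = 0" by simp
    then have "(\<Sum>b\<in>B. padic_residue (a b) *s b) = 0"
      by (simp add: lattice_reduction_sum lattice_reduction_scale w cong: sum.cong)
    then have "vec.dependent B"
      using b0(1) ab0 B(2) by (subst vec.dependent_finite)
        (auto intro!: exI [of _ "\<lambda>b. padic_residue (a b)"] bexI [of _ b0] simp: padic_residue_one)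
    then show False using B(1) by blast
  qed
qed

text \<open>A basis of the reduced image lifts to lattice vectors inside the image of
  \<open>f\<close>, and the lifts stay independent.\<close>

lemma dim_range_induced_map_le:
  fixes f :: "'p::prime_card padic ^ 'a::finite \<Rightarrow> 'p padic ^ 'a"
  assumes lin: "Vector_Spaces.linear (*s) (*s) f" and pres: "preserves_lattice f"
  shows "vec.dim (range (induced_map f)) \<le> vec.dim (range f)"
proof -
  obtain B where B: "B \<subseteq> range (induced_map f)" "vec.independent B" "card B = vec.dim (range (induced_map f))"
    using vec.basis_exists by metis
  have fin: "finite B" using B(2) by (rule vec.finiteI_independent)
  have "\<exists>w. lattice_reduction w = b \<and> lattice_embedding w \<in> range f" if b: "b \<in> B" for b
  proof -
    obtain u u' where "b = induced_map f (lattice_reduction u)"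
      "f (lattice_embedding u) = lattice_embedding u'"
      using b B(1) pres surj_lattice_reduction unfolding preserves_lattice_def by (metis imageE subsetD)
    then show ?thesis using induced_map_eq [OF lin pres] by (metis rangeI)
  qed
  then obtain w where w: "\<And>b. b \<in> B \<Longrightarrow> lattice_reduction (w b) = b"
    "\<And>b. b \<in> B \<Longrightarrow> lattice_embedding (w b) \<in> range f" by metis
  have "card ((\<lambda>b. lattice_embedding (w b)) ` B) \<le> vec.dim (range f)"
    using w(2) by (intro vec.independent_card_le_dim independent_lift B fin w(1)) auto
  then show ?thesis using B(3) by (simp add: card_image independent_lift [OF B(2) fin w(1)])
qed

text \<open>The space is the direct sum of the two images: v = f v + (v - f v), and \<open>f\<close>
  is the identity on the first summand and zero on the second.\<close>

lemma dim_range_idempotent: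
  fixes f :: "'k::field ^ 'n \<Rightarrow> 'k ^ 'n"
  assumes "Vector_Spaces.linear (*s) (*s) f" and idem: "\<And>v. f (f v) = f v"
  shows "vec.dim (range f) + vec.dim (range (\<lambda>v. v - f v)) = CARD('n)"
proof -
  interpret f: Vector_Spaces.linear "(*s)" "(*s)" f by fact
  let ?g = "\<lambda>v. v - f v"
  have "Vector_Spaces.linear (*s) (*s) ?g"
    by (simp add: linear_iff_vec f.add f.scale algebra_simps vec.scale_right_diff_distrib)
  then interpret g: Vector_Spaces.linear "(*s)" "(*s)" ?g .
  have sub: "vec.subspace (range f)" "vec.subspace (range ?g)"
    by (simp_all add: f.subspace_image g.subspace_image)
  have "range f \<inter> range ?g = {0}"
  proof (intro subset_antisym subsetI)
    fix v assume "v \<in> range f \<inter> range ?g"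
    then obtain x y where xy: "v = f x" "v = y - f y" by blast
    have "f v = v" by (simp add: xy(1) idem)
    moreover have "f v = 0" by (simp add: xy(2) f.diff idem)
    ultimately show "v \<in> {0}" by simp
  qed (use sub in \<open>auto dest: vec.subspace_0\<close>)
  then have int: "vec.dim (range f \<inter> range ?g) = 0" by simp
  have "v \<in> {x + y |x y. x \<in> range f \<and> y \<in> range ?g}" for v
    by (intro CollectI exI [of _ "f v"] exI [of _ "v - f v"]) auto
  then have "{x + y |x y. x \<in> range f \<and> y \<in> range ?g} = UNIV" by blast
  then show ?thesis using vec.dim_sums_Int [OF sub] int by (simp add: card_cart_basis)
qed

text \<open>
  Reduction can only lower the rank; for a projection it also can only lower the rank of the
  complementary projection, and the two ranks add up to the same number on both sides.
\<close>

lemma dim_range_induced_projection: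
  fixes f :: "'p::prime_card padic ^ 'a::finite \<Rightarrow> 'p padic ^ 'a"
  assumes lin: "Vector_Spaces.linear (*s) (*s) f" and pres: "preserves_lattice f"
    and idem: "\<And>v. f (f v) = f v"
  shows "vec.dim (range (induced_map f)) = vec.dim (range f)"
proof -
  interpret f: Vector_Spaces.linear "(*s)" "(*s)" f by (fact lin)
  let ?g = "\<lambda>v. v - f v"
  obtain r where r: "\<And>u. f (lattice_embedding u) = lattice_embedding (r u)"
    using pres unfolding preserves_lattice_def by metis
  have g: "Vector_Spaces.linear (*s) (*s) ?g"
    by (simp add: linear_iff_vec f.add f.scale algebra_simps vec.scale_right_diff_distrib)
  have g_r: "?g (lattice_embedding u) = lattice_embedding (u - r u)" for u
    by (simp add: lattice_embedding_diff r)
  then have g_pres: "preserves_lattice ?g" unfolding preserves_lattice_def by blast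
  have "lattice_embedding (r (r u)) = lattice_embedding (r u)" for u
    using idem [of "lattice_embedding u"] by (simp only: r)
  then have r_idem: "r (r u) = r u" for u by (simp only: lattice_embedding_eq_iff)
  have "induced_map f (induced_map f v) = induced_map f v" for v
    using surj_lattice_reduction [of v] by (auto simp: induced_map_eq [OF lin pres r] r_idem)
  then have "vec.dim (range (induced_map f)) + vec.dim (range (\<lambda>v. v - induced_map f v)) = CARD('a)"
    by (rule dim_range_idempotent [OF linear_induced_map [OF lin pres]])
  moreover have "induced_map ?g v = v - induced_map f v" for v
    using surj_lattice_reduction [of v]
    by (auto simp: induced_map_eq [OF lin pres r] induced_map_eq [OF g g_pres g_r] lattice_reduction_diff)
  then have "vec.dim (range (\<lambda>v. v - induced_map f v)) \<le> vec.dim (range ?g)"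
    using dim_range_induced_map_le [OF g g_pres] by simp
  ultimately show ?thesis
    using dim_range_idempotent [OF lin idem] dim_range_induced_map_le [OF lin pres] by linarith
qed

section \<open>Averaging over a group\<close>

definition average :: "('g, 'm) monoid_scheme \<Rightarrow> ('g \<Rightarrow> 'k::field ^ 'n \<Rightarrow> 'k ^ 'n) \<Rightarrow> 'k ^ 'n \<Rightarrow> 'k ^ 'n" where
  "average G \<sigma> v = inverse (of_nat (order G)) *s (\<Sum>g\<in>carrier G. \<sigma> g v)"

lemma linear_average:
  assumes "\<And>g. g \<in> carrier G \<Longrightarrow> Vector_Spaces.linear (*s) (*s) (\<sigma> g)"
  shows "Vector_Spaces.linear (*s) (*s) (average G \<sigma>)"
  using assms unfolding linear_iff_vec average_def
  by (simp add: sum.distrib vec.scale_right_distrib mult.commute flip: vec.scale_sum_right cong: sum.cong)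

text \<open>Averaging is the identity on fixed vectors, and its values are fixed because left
  multiplication by a group element permutes the summands.\<close>

lemma
  assumes "group G" and lin: "\<And>g. g \<in> carrier G \<Longrightarrow> Vector_Spaces.linear (*s) (*s) (\<sigma> g)"
    and mult: "\<And>g h v. g \<in> carrier G \<Longrightarrow> h \<in> carrier G \<Longrightarrow> \<sigma> (g \<otimes>\<^bsub>G\<^esub> h) v = \<sigma> g (\<sigma> h v)"
    and nz: "of_nat (order G) \<noteq> (0 :: 'k::field)"
  shows range_average: "range (average G \<sigma>) = fixed_vectors G (\<sigma> :: _ \<Rightarrow> 'k ^ 'n \<Rightarrow> 'k ^ 'n)"
    and average_average: "average G \<sigma> (average G \<sigma> v) = average G \<sigma> v"
proof -
  interpret group G by fact
  have fixed: "average G \<sigma> v = v" if "v \<in> fixed_vectors G \<sigma>" for v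
  proof -
    have "(\<Sum>g\<in>carrier G. \<sigma> g v) = (\<Sum>g\<in>carrier G. 1 *s v)"
      using that by (intro sum.cong) (auto simp: fixed_vectors_def)
    also have "\<dots> = of_nat (order G) *s v" by (simp only: order_def vec.sum_constant_scale vec.scale_one)
    finally show ?thesis using nz by (simp add: average_def)
  qed
  have in_fixed: "average G \<sigma> v \<in> fixed_vectors G \<sigma>" for v
    unfolding fixed_vectors_def
  proof (intro CollectI ballI)
    fix h assume h: "h \<in> carrier G"
    interpret h: Vector_Spaces.linear "(*s)" "(*s)" "\<sigma> h" by (rule lin [OF h])
    have "(\<Sum>g\<in>carrier G. \<sigma> h (\<sigma> g v)) = (\<Sum>g\<in>carrier G. \<sigma> g v)"
    proof (rule sum.reindex_bij_witness)
      fix g assume g: "g \<in> carrier G"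
      show "inv\<^bsub>G\<^esub> h \<otimes>\<^bsub>G\<^esub> (h \<otimes>\<^bsub>G\<^esub> g) = g" "h \<otimes>\<^bsub>G\<^esub> g \<in> carrier G"
        "h \<otimes>\<^bsub>G\<^esub> (inv\<^bsub>G\<^esub> h \<otimes>\<^bsub>G\<^esub> g) = g" "inv\<^bsub>G\<^esub> h \<otimes>\<^bsub>G\<^esub> g \<in> carrier G"
        using g h by (simp_all flip: m_assoc)
      show "\<sigma> (h \<otimes>\<^bsub>G\<^esub> g) v = \<sigma> h (\<sigma> g v)" by (rule mult [OF h g])
    qed
    then show "\<sigma> h (average G \<sigma> v) = average G \<sigma> v"
      by (simp add: average_def h.scale h.sum)
  qed
  show "range (average G \<sigma>) = fixed_vectors G \<sigma>" using fixed in_fixed by (metis image_subset_iff rangeI subsetI subset_antisym)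
  show "average G \<sigma> (average G \<sigma> v) = average G \<sigma> v" by (rule fixed [OF in_fixed])
qed

text \<open>The group order is a unit of Z_l, so a single \<open>c\<close> gives its inverse in Q_l
  and, through its residue, in F_l. Hence reducing the averaging projection yields the averaging
  projection of the reduced action, and the two fixed spaces are the ranges of a projection and of
  its reduction.\<close>

lemma dim_fixed_vectors_induced:
  fixes \<sigma> :: "'g \<Rightarrow> 'p::prime_card padic ^ 'a::finite \<Rightarrow> 'p padic ^ 'a"
  assumes "group G" "finite (carrier G)" and ndvd: "\<not> CARD('p) dvd order G"
    and lin: "\<And>g. g \<in> carrier G \<Longrightarrow> Vector_Spaces.linear (*s) (*s) (\<sigma> g)"
    and mult: "\<And>g h v. g \<in> carrier G \<Longrightarrow> h \<in> carrier G \<Longrightarrow> \<sigma> (g \<otimes>\<^bsub>G\<^esub> h) v = \<sigma> g (\<sigma> h v)"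
    and pres: "\<And>g. g \<in> carrier G \<Longrightarrow> preserves_lattice (\<sigma> g)"
  shows "vec.dim (fixed_vectors G \<sigma>) = vec.dim (fixed_vectors G (\<lambda>g. induced_map (\<sigma> g)))"
proof -
  interpret group G by fact
  let ?\<tau> = "\<lambda>g. induced_map (\<sigma> g)"
  obtain r where r: "\<And>g u. g \<in> carrier G \<Longrightarrow> \<sigma> g (lattice_embedding u) = lattice_embedding (r g u)"
    using pres unfolding preserves_lattice_def by metis
  have \<tau>: "?\<tau> g (lattice_reduction u) = lattice_reduction (r g u)" if "g \<in> carrier G" for g u
    using that by (intro induced_map_eq lin pres r)
  obtain c :: "'p padic_int" where c: "c * of_nat (order G) = 1"
    using padic_inverse_of_nat_integral [OF ndvd] by blast
  have "padic_of_int c * of_nat (order G) = 1"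
    using arg_cong [OF c, of padic_of_int] by simp
  then have c_inv: "inverse (of_nat (order G)) = padic_of_int c" and nz: "of_nat (order G) \<noteq> (0 :: 'p padic)"
    by (auto simp: inverse_unique mult.commute)
  have "padic_residue c * of_nat (order G) = 1"
    using arg_cong [OF c, of padic_residue] by (simp add: padic_residue_mult padic_residue_of_nat padic_residue_one)
  then have c_inv': "inverse (of_nat (order G)) = padic_residue c" and nz': "of_nat (order G) \<noteq> (0 :: 'p mod_ring)"
    by (auto simp: inverse_unique mult.commute)
  have avg: "average G \<sigma> (lattice_embedding u) = lattice_embedding (c *s (\<Sum>g\<in>carrier G. r g u))" for u
    by (simp add: average_def c_inv lattice_embedding_scale lattice_embedding_sum r cong: sum.cong)
  then have avg_pres: "preserves_lattice (average G \<sigma>)" unfolding preserves_lattice_def by blast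
  note avg_lin = linear_average [OF lin]
  have avg': "induced_map (average G \<sigma>) v = average G ?\<tau> v" for v
  proof -
    obtain u where v: "v = lattice_reduction u" using surj_lattice_reduction by metis
    show ?thesis unfolding v
      by (simp add: induced_map_eq [OF avg_lin avg_pres avg] average_def c_inv' lattice_reduction_scale
          lattice_reduction_sum \<tau> cong: sum.cong)
  qed
  have \<tau>_mult: "?\<tau> (g \<otimes>\<^bsub>G\<^esub> h) v = ?\<tau> g (?\<tau> h v)" if gh: "g \<in> carrier G" "h \<in> carrier G" for g h v
  proof -
    obtain u where v: "v = lattice_reduction u" using surj_lattice_reduction by metis
    have "lattice_embedding (r (g \<otimes>\<^bsub>G\<^esub> h) u) = lattice_embedding (r g (r h u))"
      using gh mult [OF gh, of "lattice_embedding u"] by (simp only: r m_closed)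
    then show ?thesis using gh by (simp add: v \<tau>)
  qed
  have "fixed_vectors G \<sigma> = range (average G \<sigma>)"
    using range_average [OF \<open>group G\<close> lin mult nz] by simp
  moreover have "fixed_vectors G ?\<tau> = range (induced_map (average G \<sigma>))"
    using range_average [OF \<open>group G\<close> linear_induced_map [OF lin pres] \<tau>_mult nz'] avg' by simp
  ultimately show ?thesis
    using dim_range_induced_projection [OF avg_lin avg_pres average_average [OF \<open>group G\<close> lin mult nz]]
    by simp
qed

text \<open>The matrix entries of T and S are built from powers of the root of unity and 1/|A|, all
  integral. Preserving the lattice is stable under composition, so it extends to the group generated
  by T and S.\<close>

lemma weil_action_preserves_lattice:
  fixes Q :: "'a::{finite,ab_group_add} \<Rightarrow> rat_mod_int" and \<zeta> :: "'p::prime_card padic"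
  assumes fqm: "finite_quadratic_module Q" and cong: "[CARD('p) = 1] (mod level Q)"
    and root: "primitive_root_of_unity (level Q) \<zeta>" and weil: "is_weil_representation Q \<zeta> \<rho>"
    and g: "g \<in> carrier (SL2 (ZFact (int (level Q))))"
  shows "preserves_lattice (\<rho> g)"
proof -
  let ?N = "level Q" let ?R = "ZFact (int ?N)" let ?e = "exp_root ?N \<zeta>"
  let ?w = "inverse (of_nat CARD('a)) * (\<Sum>x\<in>UNIV. ?e (- Q x))"
  have N: "?N > 0" and \<zeta>: "\<zeta> ^ ?N = 1" using root by (auto simp: primitive_root_of_unity_def)
  have action: "group_action (SL2 ?R) UNIV \<rho>"
    and lin: "h \<in> carrier (SL2 ?R) \<Longrightarrow> Vector_Spaces.linear (*s) (*s) (\<rho> h)"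
    and T: "\<rho> (SL2_T ?R) (axis x 1) = ?e (Q x) *s axis x 1"
    and S: "\<rho> (SL2_S ?R) (axis x 1) = ?w *s (\<Sum>y\<in>UNIV. ?e (- polar Q x y) *s axis y 1)" for h x
    using weil by (simp_all add: is_weil_representation_def Let_def)
  interpret group_action "SL2 ?R" UNIV \<rho> by (fact action)
  interpret G: group "SL2 ?R" by (rule group_SL2_ZFact)
  obtain z where z: "\<zeta> = padic_of_int z" using padic_root_of_unity_integral [OF \<zeta> N] by blast
  \<comment> \<open>Whatever exponent the description in \<open>exp_root\<close> denotes, the value
    is a power of the root of unity, so integrality holds for every \<open>q\<close>.\<close>
  have e: "\<exists>a. ?e q = padic_of_int a" for q
    unfolding exp_root_def z by (metis padic_of_int_power)
  then obtain e' where e': "?e q = padic_of_int (e' q)" for q by metis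
  obtain c :: "'p padic_int" where c: "c * of_nat CARD('a) = 1"
    using padic_inverse_of_nat_integral [OF not_prime_dvd_card_module [OF fqm prime_card cong]] by blast
  have "padic_of_int c * of_nat CARD('a) = 1"
    using arg_cong [OF c, of padic_of_int] by simp
  then have "inverse (of_nat CARD('a)) = padic_of_int c" by (simp add: inverse_unique mult.commute)
  then have w: "?w = padic_of_int (c * (\<Sum>x\<in>UNIV. e' (- Q x)))"
    by (simp add: padic_of_int_sum e')
  have axis: "axis x 1 \<in> range lattice_embedding" for x :: 'a
    by (metis lattice_embedding_axis rangeI)
  have T_mem: "SL2_T ?R \<in> carrier (SL2 ?R)" and S_mem: "SL2_S ?R \<in> carrier (SL2 ?R)"
    by (auto simp: SL2_T_ZFact SL2_S_ZFact carrier_SL2_ZFact)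
  \<comment> \<open>Membership in the carrier is kept in the set so that the composition rule of the
    action is available for products.\<close>
  have "carrier (SL2 ?R) \<subseteq> {h \<in> carrier (SL2 ?R). preserves_lattice (\<rho> h)}"
  proof (rule SL2_ZFact_generated [OF N])
    have "preserves_lattice (\<rho> (SL2_T ?R))"
      by (intro preserves_lattice_if_axis lin T_mem) (simp only: T e' in_lattice_scale axis)
    then show "SL2_T ?R \<in> {h \<in> carrier (SL2 ?R). preserves_lattice (\<rho> h)}" using T_mem by simp
    have "preserves_lattice (\<rho> (SL2_S ?R))"
      by (intro preserves_lattice_if_axis lin S_mem)
        (subst S, subst w, intro in_lattice_scale in_lattice_sum, simp only: e' in_lattice_scale axis)
    then show "SL2_S ?R \<in> {h \<in> carrier (SL2 ?R). preserves_lattice (\<rho> h)}" using S_mem by simp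
  next
    fix h k assume "h \<in> {h \<in> carrier (SL2 ?R). preserves_lattice (\<rho> h)}"
      "k \<in> {h \<in> carrier (SL2 ?R). preserves_lattice (\<rho> h)}"
    then show "h \<otimes>\<^bsub>SL2 ?R\<^esub> k \<in> {h \<in> carrier (SL2 ?R). preserves_lattice (\<rho> h)}"
      by (simp add: preserves_lattice_def composition_rule) metis
  qed
  then show ?thesis using g by blast
qed

text \<open>The first conjunct is what gives \<open>induced_map\<close> its meaning as the action on
  the lattice modulo the prime; without it the description there might denote nothing.\<close>

theorem theorem5p1:
  fixes Q :: "'a::{finite,ab_group_add} \<Rightarrow> rat_mod_int"
    and N :: nat
    and \<zeta> :: "'p::prime_card padic"
    and \<rho> :: "int set \<times> int set \<times> int set \<times> int set \<Rightarrow> ('p padic, 'a) vec \<Rightarrow> ('p padic, 'a) vec"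
  assumes "finite_quadratic_module Q"
    and "N = level Q"
    and "even (signature Q)"
    and "[CARD('p) = 1] (mod N)"
    and "(N, CARD('p)) \<noteq> (2, 3)"
    and "primitive_root_of_unity N \<zeta>"
    and "is_weil_representation Q \<zeta> \<rho>"
    and "G = SL2 (ZFact (int N))"
  shows "(\<forall>g\<in>carrier G. \<forall>u. \<exists>u'. \<rho> g (lattice_embedding u) = lattice_embedding u') \<and>
    vec.dim (fixed_vectors G \<rho>) = vec.dim (fixed_vectors G (\<lambda>g. induced_map (\<rho> g)))"
proof -
  have N: "N > 0" using assms(6) by (simp add: primitive_root_of_unity_def)
  have pres: "preserves_lattice (\<rho> g)" if "g \<in> carrier G" for g
    using that assms weil_action_preserves_lattice by blast
  have action: "group_action G UNIV \<rho>"
    and lin: "\<And>g. g \<in> carrier G \<Longrightarrow> Vector_Spaces.linear (*s) (*s) (\<rho> g)"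
    using assms(2,7,8) by (simp_all add: is_weil_representation_def Let_def)
  have "vec.dim (fixed_vectors G \<rho>) = vec.dim (fixed_vectors G (\<lambda>g. induced_map (\<rho> g)))"
  proof (rule dim_fixed_vectors_induced)
    show "group G" using assms(8) by (simp add: group_SL2_ZFact)
    show "finite (carrier G)" using assms(8) N by (simp add: finite_carrier_SL2_ZFact)
    show "\<not> CARD('p) dvd order G"
      unfolding assms(8)
      by (intro not_prime_dvd_order_SL2_ZFact N prime_card prime_factor_less [OF prime_card assms(4,5)])
    show "\<rho> (g \<otimes>\<^bsub>G\<^esub> h) v = \<rho> g (\<rho> h v)" if "g \<in> carrier G" "h \<in> carrier G" for g h v
      using group_action.composition_rule [OF action _ that] by simp
  qed (fact lin pres)+
  then show ?thesis using pres by (simp add: preserves_lattice_def)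
qed

end
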